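(* Let $n\ge1$ and $s\in(0,1)$. There exists a constant $C=C(n,s)>0$ such that the following holds. Let $\varphi:\mathbb{R}^n\to\mathbb{R}$ be a measurable function, $R>0$, $A\subset B_{2R}$ an open set and $\psi\in L^\infty(A)$. If $u\in\mathcal{W}^s_{\varphi,\psi}(B_{2R},A)$ solves the obstacle problem in $B_{2R}$ with exterior data $\varphi$ and obstacle $\psi$ in $A$, then $$\sup_{B_R}u\le\max\left\{C\left(R+\frac{1}{|B_{2R}|}\int_{B_{2R}}u_+(x)\,dx\right),\ \sup_A\psi_+\right\}.$$
   Context: $B_r$ is the open ball of radius $r$ in $\mathbb{R}^n$ centered at the origin; $u_+=\max\{u,0\}$. Suprema of measurable functions are essential suprema. Obstacle problem. Set $g_s(t)=(1+t^2)^{-\frac{n+1+s}{2}}$, $G_s(t)=\int_0^t g_s(\tau)\,d\tau$, $\mathcal{G}_s(t)=\int_0^tG_s(\tau)\,d\tau$. For a bounded open $\Omega\subset\mathbb{R}^n$ with Lipschitz boundary, let $Q(\Omega)=\mathbb{R}^{2n}\setminus(\mathbb{R}^n\setminus\Omega)^2$. $\mathcal{W}^s(\Omega)$ is the set of (measurable) $u:\mathbb{R}^n\to\mathbb{R}$ with $u|_\Omega\in W^{s,1}(\Omega)$, i.e. $\|u\|_{L^1(\Omega)}+\int_\Omega\int_\Omega\frac{|u(x)-u(y)|}{|x-y|^{n+s}}\,dx\,dy<\infty$. For $A\subset\Omega$ open and $\psi\in L^\infty(A)$, $$\mathcal{W}^s_{\varphi,\psi}(\Omega,A):=\{u\in\mathcal{W}^s(\Omega):u=\varphi\text{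 on }\mathbb{R}^n\setminus\Omega,\ u\ge\psi\text{ a.e. in }A\}.$$ A function $u$ solves the obstacle problem (in $\Omega$, with exterior data $\varphi$ and obstacle $\psi$ in $A$) if $u\in\mathcal{W}^s_{\varphi,\psi}(\Omega,A)$ and for every $v\in\mathcal{W}^s_{\varphi,\psi}(\Omega,A)$ $$\iint_{Q(\Omega)}\left\{\mathcal{G}_s\Big(\tfrac{u(x)-u(y)}{|x-y|}\Big)-\mathcal{G}_s\Big(\tfrac{v(x)-v(y)}{|x-y|}\Big)\right\}\frac{dx\,dy}{|x-y|^{n-1+s}}\le0.$$ *)

theory Defs
  imports "HOL-Analysis.Analysis" "HOL-Probability.Essential_Supremum"
begin

(* Points of R^n are vectors of type real^'n, with n = CARD('n); measurability and all
   integrals over R^n and R^(2n) refer to Lebesgue measure.  The kernels g_dens, G_int and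
   GG_int (the functions g_s, G_s and calligraphic G_s) take the dimension n as an
   explicit argument. *)

definition g_dens :: "nat \<Rightarrow> real \<Rightarrow> real \<Rightarrow> real" where
  "g_dens n s t = (1 + t\<^sup>2) powr (- ((real n + 1 + s) / 2))"

(* The interval integral is oriented, so G_int is odd and GG_int is even. *)
definition G_int :: "nat \<Rightarrow> real \<Rightarrow> real \<Rightarrow> real" where
  "G_int n s t = (LBINT \<tau>=ereal 0..ereal t. g_dens n s \<tau>)"

definition GG_int :: "nat \<Rightarrow> real \<Rightarrow> real \<Rightarrow> real" where
  "GG_int n s t = (LBINT \<tau>=ereal 0..ereal t. G_int n s \<tau>)"

definition Q_dom :: "(real^'n) set \<Rightarrow> ((real^'n) \<times> (real^'n)) set" where
  "Q_dom \<Omega> = UNIV - (UNIV - \<Omega>) \<times> (UNIV - \<Omega>)"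

(* On the diagonal x = y the quotients below evaluate to 0 (division by zero);
   the diagonal is a null set. *)
definition W_space :: "real \<Rightarrow> (real^'n) set \<Rightarrow> (real^'n \<Rightarrow> real) set" where
  "W_space s \<Omega> = {u. u \<in> borel_measurable lebesgue \<and>
     (\<integral>\<^sup>+x\<in>\<Omega>. ennreal \<bar>u x\<bar> \<partial>lebesgue)
     + (\<integral>\<^sup>+x\<in>\<Omega>. (\<integral>\<^sup>+y\<in>\<Omega>.
          ennreal (\<bar>u x - u y\<bar> / norm (x - y) powr (real CARD('n) + s)) \<partial>lebesgue) \<partial>lebesgue) < \<infinity>}"

definition L_infty :: "(real^'n) set \<Rightarrow> (real^'n \<Rightarrow> real) set" where
  "L_infty A = {\<psi>. \<psi> \<in> borel_measurable (lebesgue_on A) \<and>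
     esssup (lebesgue_on A) (\<lambda>x. ereal \<bar>\<psi> x\<bar>) < \<infinity>}"

definition W_obst ::
  "real \<Rightarrow> (real^'n \<Rightarrow> real) \<Rightarrow> (real^'n \<Rightarrow> real) \<Rightarrow> (real^'n) set \<Rightarrow> (real^'n) set
    \<Rightarrow> (real^'n \<Rightarrow> real) set" where
  "W_obst s \<phi> \<psi> \<Omega> A = {u \<in> W_space s \<Omega>.
     (\<forall>x. x \<notin> \<Omega> \<longrightarrow> u x = \<phi> x) \<and> (AE x in lebesgue. x \<in> A \<longrightarrow> \<psi> x \<le> u x)}"

(* For bounded open sets with Lipschitz boundary (in particular balls) the integrand is
   absolutely integrable on Q_dom: GG_int is Lipschitz and w = u - v vanishes outside
   the domain, so the integrand is bounded by a multiple of
   |w(x) - w(y)| / |x - y|^(n+s), which is integrable by the fractional Hardy inequality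
   for W^{s,1}, s < 1.  Hence the value 0 that the Bochner integral assigns to
   non-integrable functions plays no role. *)
definition solves_obstacle ::
  "real \<Rightarrow> (real^'n \<Rightarrow> real) \<Rightarrow> (real^'n \<Rightarrow> real) \<Rightarrow> (real^'n) set \<Rightarrow> (real^'n) set
    \<Rightarrow> (real^'n \<Rightarrow> real) \<Rightarrow> bool" where
  "solves_obstacle s \<phi> \<psi> \<Omega> A u \<longleftrightarrow> u \<in> W_obst s \<phi> \<psi> \<Omega> A \<and>
     (\<forall>v \<in> W_obst s \<phi> \<psi> \<Omega> A.
        (LINT p:Q_dom \<Omega>|lebesgue. (case p of (x, y) \<Rightarrow>
           (GG_int CARD('n) s ((u x - u y) / norm (x - y))
            - GG_int CARD('n) s ((v x - v y) / norm (x - y)))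
           * (1 / norm (x - y) powr (real CARD('n) - 1 + s)))) \<le> 0)"

end

theory Submission
  imports Defs
begin

text \<open>
  Let $u$ solve the obstacle problem and let $k \ge \sup_A \psi$.  Cutting off the part of $u$ above a
  level $\ge k$ never violates the obstacle, so whenever $w \ge 0$ is such a part, supported inside the
  domain, $u - w$ is a competitor and the energy of $u$ does not exceed the energy of $u - w$.  The whole
  proof feeds this inequality with one family of cut-offs, $w = (\min(u, k + \sigma) - \zeta)_+$, where the
  barrier $\zeta$ is a bowl: it equals $k$ on $B_\rho$ and rises to $k + \sigma$ on the boundary of
  $B_{\rho + \sigma}$.  Height and width of the collar are both $\sigma$, so slopes are bounded by $2$ at all
  scales.

  The gain.  If $w(x) > 0$, $u(y) \le k - \sigma$ and $|x - y| \le \sigma$, then the difference quotient stays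
  at least $1$ after the cut, where $G_s$ is bounded below; so this pair saves at least
  $c\, w(x) |x - y|^{-n-s}$.  If the set $\{u > k - \sigma\}$ fills at most half of each ball
  $B_{\epsilon\sigma}(x)$, integrating over the other half of that ball gives a total gain of
  $c\, (\epsilon\sigma)^{-s} \int w$, and this constant improves without bound as $\epsilon \to 0$.

  The cost is estimated in two ways.  Since $\zeta$ is Lipschitz, it is always at most a multiple of
  $\sigma^{1-s} |\{w > 0\}|$; comparing with the gain shows that the measure of superlevel sets drops by a
  factor $2^{-n}$ when the scale is halved (\<open>superlevel_decay\<close>), and a geometric iteration yields
  $u \le N + R/8$ on $B_{5R/4}$ as soon as $\{u > N\}$ is small in $B_{3R/2}$ (\<open>bounded_by_level\<close>).  This
  still overshoots the level $N$.  Once $u$ is bounded by $k + \sigma$ near the support of $w$, though, the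
  cut is $\min(u, \zeta)$ there, and by convexity the cost is a linear expression in $w$ that pairs it with
  the nonlocal mean curvature of $\zeta$.  As $\zeta$ is semiconcave this is at most a multiple of
  $\sigma^{-s} \int w$ (\<open>barrier_flux_bound\<close>), which the gain beats; hence $w = 0$ and $u \le N$ on $B_R$
  without any loss (\<open>barrier_comparison\<close>).  That is why the supremum of the obstacle enters the bound
  with constant $1$.

  It remains to take $N$ as the right-hand side of the claim: the obstacle then lies below $N$, and if the
  constant $C$ is large, Chebyshev's inequality makes $\{u > N/2\}$ as small as both steps require.
\<close>

section \<open>Convexity and growth of the integrand\<close>

lemma interval_integral_from_zero_deriv:
  fixes f :: "real \<Rightarrow> real"
  assumes "continuous_on UNIV f"
  shows "((\<lambda>t. LBINT \<tau>=ereal 0..ereal t. f \<tau>) has_real_derivative f t) (at t)"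
proof -
  define b where "b = \<bar>t\<bar> + 1"
  have "((\<lambda>u. LBINT y=ereal 0..ereal u. f y) has_vector_derivative f t) (at t within {-b..b})"
    unfolding b_def by (rule interval_integral_FTC2) (simp_all add: continuous_on_subset[OF assms])
  moreover have "t \<in> interior {-b..b}" by (auto simp: b_def)
  ultimately show ?thesis
    by (simp only: at_within_interior has_real_derivative_iff_has_vector_derivative)
qed

lemma g_dens_pos: "0 < g_dens n s t"
  using zero_le_power2[of t] unfolding g_dens_def powr_gt_zero by linarith

lemma continuous_g_dens: "continuous_on UNIV (g_dens n s)"
proof -
  have "1 + t\<^sup>2 \<noteq> 0" for t :: real using zero_le_power2[of t] by linarith
  then show ?thesis unfolding g_dens_def by (intro continuous_intros) auto
qed

lemma g_dens_antimono:
  assumes "0 < s" "\<bar>t\<bar> \<le> \<bar>r\<bar>" shows "g_dens n s r \<le> g_dens n s t"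
  unfolding g_dens_def using assms
  by (intro powr_mono2') (auto simp: add_pos_nonneg abs_le_square_iff)

lemma g_dens_le_one: assumes "0 < s" shows "g_dens n s t \<le> 1"
  using g_dens_antimono[of s 0 t n] assms by (simp add: g_dens_def)

lemma g_dens_le_arctan_deriv:
  assumes "0 < s" "1 \<le> n" shows "g_dens n s t \<le> inverse (1 + t\<^sup>2)"
proof -
  have "g_dens n s t \<le> (1 + t\<^sup>2) powr (-1)"
    unfolding g_dens_def using assms by (intro powr_mono) simp_all
  also have "\<dots> = inverse (1 + t\<^sup>2)" by (subst powr_minus) (simp add: add_pos_nonneg)
  finally show ?thesis .
qed

lemma G_int_0 [simp]: "G_int n s 0 = 0"
  by (simp only: G_int_def interval_integral_endpoints_same)

lemma G_int_deriv: "(G_int n s has_real_derivative g_dens n s t) (at t)"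
  unfolding G_int_def[abs_def]
  by (rule interval_integral_from_zero_deriv[OF continuous_g_dens])

lemma continuous_G_int: "continuous_on UNIV (G_int n s)"
  by (meson G_int_deriv DERIV_isCont continuous_at_imp_continuous_on)

lemma GG_int_deriv: "(GG_int n s has_real_derivative G_int n s t) (at t)"
  unfolding GG_int_def[abs_def]
  by (rule interval_integral_from_zero_deriv[OF continuous_G_int])

lemma continuous_GG_int: "continuous_on UNIV (GG_int n s)"
  by (meson GG_int_deriv DERIV_isCont continuous_at_imp_continuous_on)

lemma borel_measurable_G_int [measurable]: "G_int n s \<in> borel_measurable borel"
  by (intro borel_measurable_continuous_onI continuous_G_int)

lemma borel_measurable_GG_int [measurable]: "GG_int n s \<in> borel_measurable borel"
  by (intro borel_measurable_continuous_onI continuous_GG_int)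

lemma G_int_mono: "a \<le> b \<Longrightarrow> G_int n s a \<le> G_int n s b"
  by (rule DERIV_nonneg_imp_nondecreasing[where f = "G_int n s"])
     (use G_int_deriv g_dens_pos in \<open>auto intro!: exI less_imp_le\<close>)

lemma G_int_odd: "G_int n s (- t) = - G_int n s t"
proof -
  have "((\<lambda>t. G_int n s (- t) + G_int n s t) has_real_derivative 0) (at t)" for t
  proof -
    have "((\<lambda>t. G_int n s (- t)) has_real_derivative g_dens n s (- t) * (- 1)) (at t)"
      by (rule DERIV_chain2[OF G_int_deriv]) (auto intro!: derivative_eq_intros)
    from DERIV_add[OF this G_int_deriv[of n s t]] show ?thesis by (simp add: g_dens_def)
  qed
  from DERIV_isconst_all[of "\<lambda>t. G_int n s (- t) + G_int n s t" t 0] this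
  show ?thesis by simp
qed

lemma GG_int_even: "GG_int n s (- t) = GG_int n s t"
proof -
  have "((\<lambda>t. GG_int n s (- t) - GG_int n s t) has_real_derivative 0) (at t)" for t
  proof -
    have "((\<lambda>t. GG_int n s (- t)) has_real_derivative G_int n s (- t) * (- 1)) (at t)"
      by (rule DERIV_chain2[OF GG_int_deriv]) (auto intro!: derivative_eq_intros)
    from DERIV_diff[OF this GG_int_deriv[of n s t]] show ?thesis by (simp add: G_int_odd)
  qed
  from DERIV_isconst_all[of "\<lambda>t. GG_int n s (- t) - GG_int n s t" t 0] this
  show ?thesis by simp
qed

lemma G_int_lipschitz:
  assumes "0 < s" "a \<le> b" shows "G_int n s b - G_int n s a \<le> b - a"
proof -
  have "a - G_int n s a \<le> b - G_int n s b"
  proof (rule DERIV_nonneg_imp_nondecreasing[OF assms(2)])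
    fix x show "\<exists>y. ((\<lambda>t. t - G_int n s t) has_real_derivative y) (at x) \<and> 0 \<le> y"
      by (rule exI[of _ "1 - g_dens n s x"])
         (auto intro!: derivative_eq_intros G_int_deriv g_dens_le_one assms)
  qed
  then show ?thesis by simp
qed

lemma abs_G_int_le_2:
  assumes "0 < s" "1 \<le> n" shows "\<bar>G_int n s t\<bar> \<le> 2"
proof -
  have *: "\<bar>G_int n s t\<bar> \<le> 2" if "0 \<le> t" for t
  proof -
    have "arctan 0 - G_int n s 0 \<le> arctan t - G_int n s t"
    proof (rule DERIV_nonneg_imp_nondecreasing[OF that])
      fix x show "\<exists>y. ((\<lambda>t. arctan t - G_int n s t) has_real_derivative y) (at x) \<and> 0 \<le> y"
        by (rule exI[of _ "inverse (1 + x\<^sup>2) - g_dens n s x"])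
           (use g_dens_le_arctan_deriv[OF assms] in \<open>auto intro!: derivative_eq_intros G_int_deriv\<close>)
    qed
    then show ?thesis
      using arctan_ubound[of t] pi_less_4 G_int_mono[OF that, of n s] by auto
  qed
  show ?thesis
    using *[of t] *[of "- t"] by (cases "0 \<le> t") (auto simp: G_int_odd)
qed

text \<open>On the interval $[-2,3]$ the slope of \<^const>\<open>G_int\<close> is at least its value at $3$; by
monotonicity a unit step to the right therefore gains a fixed amount, however long it is.\<close>
lemma G_int_step:
  assumes "0 < s" "\<bar>t\<bar> \<le> 2" "t + 1 \<le> r"
  shows "G_int n s t + g_dens n s 3 \<le> G_int n s r"
proof -
  have "G_int n s t - g_dens n s 3 * t \<le> G_int n s (t + 1) - g_dens n s 3 * (t + 1)"
  proof (rule DERIV_nonneg_imp_nondecreasing[where f = "\<lambda>t. G_int n s t - g_dens n s 3 * t"])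
    fix x assume "t \<le> x" "x \<le> t + 1"
    then have "\<bar>x\<bar> \<le> \<bar>3\<bar>" using assms by auto
    from g_dens_antimono[OF assms(1) this, of n]
    show "\<exists>y. ((\<lambda>t. G_int n s t - g_dens n s 3 * t) has_real_derivative y) (at x) \<and> 0 \<le> y"
      by (intro exI[of _ "g_dens n s x - g_dens n s 3"])
         (auto intro!: derivative_eq_intros G_int_deriv)
  qed simp
  then show ?thesis using G_int_mono[OF assms(3), of n s] by (simp add: algebra_simps)
qed

lemma GG_int_convex: "G_int n s b * (a - b) \<le> GG_int n s a - GG_int n s b"
proof -
  let ?f = "\<lambda>t. GG_int n s t - G_int n s b * t"
  have d: "(?f has_real_derivative G_int n s x - G_int n s b) (at x)" for x
    by (auto intro!: derivative_eq_intros GG_int_deriv)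
  have "?f b \<le> ?f a"
  proof (cases "b \<le> a")
    case True
    have "\<exists>y. (?f has_real_derivative y) (at x) \<and> 0 \<le> y" if "b \<le> x" for x
      using G_int_mono[OF that, of n s] by (intro exI[of _ "G_int n s x - G_int n s b"] conjI d) simp
    then show ?thesis by (intro DERIV_nonneg_imp_nondecreasing[OF True]) blast
  next
    case False
    have "\<exists>y. (?f has_real_derivative y) (at x) \<and> y \<le> 0" if "x \<le> b" for x
      using G_int_mono[OF that, of n s] by (intro exI[of _ "G_int n s x - G_int n s b"] conjI d) simp
    with False show ?thesis by (intro DERIV_nonpos_imp_nonincreasing[of a b ?f]) auto
  qed
  then show ?thesis by (simp add: algebra_simps)
qed

lemma GG_int_lipschitz:
  assumes "0 < s" "1 \<le> n" shows "\<bar>GG_int n s a - GG_int n s b\<bar> \<le> 2 * \<bar>a - b\<bar>"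
proof -
  have *: "GG_int n s b - GG_int n s a \<le> 2 * \<bar>a - b\<bar>" for a b
  proof -
    have "\<bar>G_int n s b * (a - b)\<bar> \<le> 2 * \<bar>a - b\<bar>"
      unfolding abs_mult by (intro mult_right_mono abs_G_int_le_2 assms) auto
    then show ?thesis using GG_int_convex[of n s b a] by linarith
  qed
  show ?thesis using *[of a b] *[of b a] by (simp add: abs_le_iff abs_minus_commute)
qed

lemma GG_int_abs_mono:
  assumes "\<bar>a\<bar> \<le> \<bar>b\<bar>" shows "GG_int n s a \<le> GG_int n s b"
proof -
  have "GG_int n s \<bar>a\<bar> \<le> GG_int n s \<bar>b\<bar>"
  proof -
    have "0 \<le> G_int n s \<bar>a\<bar> * (\<bar>b\<bar> - \<bar>a\<bar>)"
      using assms G_int_mono[of 0 "\<bar>a\<bar>" n s] by (intro mult_nonneg_nonneg) auto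
    then show ?thesis using GG_int_convex[of n s "\<bar>a\<bar>" "\<bar>b\<bar>"] by linarith
  qed
  moreover have "GG_int n s \<bar>x\<bar> = GG_int n s x" for x
    by (cases "0 \<le> x") (simp_all add: GG_int_even)
  ultimately show ?thesis by simp
qed

section \<open>The singular kernel\<close>

definition frac_ker :: "real \<Rightarrow> real^'n \<Rightarrow> real" where
  "frac_ker s z = 1 / norm z powr (real CARD('n) + s)"

text \<open>A Lipschitz function that oscillates by at most its Lipschitz constant times $\sigma$ changes
  between $x$ and $y$ by at most a multiple of $\sigma$ times this quantity at $x - y$.\<close>
definition near :: "real \<Rightarrow> real^'n \<Rightarrow> real" where
  "near \<sigma> z = min 1 (norm z / \<sigma>)"

lemma frac_ker_nonneg [simp]: "0 \<le> frac_ker s z"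
  by (simp add: frac_ker_def)

lemma frac_ker_minus [simp]: "frac_ker s (- z) = frac_ker s z" "near \<sigma> (- z) = near \<sigma> z"
  by (simp_all add: frac_ker_def near_def)

lemma near_nonneg: "0 < \<sigma> \<Longrightarrow> 0 \<le> near \<sigma> z"
  by (simp add: near_def)

lemma borel_measurable_frac_ker [measurable]: "frac_ker s \<in> borel_measurable borel"
  unfolding frac_ker_def[abs_def] by measurable

lemma borel_measurable_near [measurable]: "near \<sigma> \<in> borel_measurable borel"
  unfolding near_def[abs_def] by measurable

lemma dyadic_shell_below:
  fixes d \<sigma> :: real
  assumes "0 < d" "d \<le> \<sigma>"
  obtains j :: nat where "\<sigma> * (1/2) ^ Suc j < d" "d \<le> \<sigma> * (1/2) ^ j"
proof -
  have "0 < \<sigma>" using assms by simp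
  obtain m where m: "(1/2) ^ m < d / \<sigma>"
    using real_arch_pow_inv[of "d / \<sigma>" "1/2"] assms \<open>0 < \<sigma>\<close> by auto
  define j where "j = (LEAST i. \<sigma> * (1/2) ^ Suc i < d)"
  have ex: "\<sigma> * (1/2) ^ Suc m < d"
  proof -
    have "\<sigma> * (1/2) ^ Suc m \<le> \<sigma> * (1/2) ^ m" using \<open>0 < \<sigma>\<close> by simp
    also have "\<dots> < d" using m \<open>0 < \<sigma>\<close> by (simp add: field_simps)
    finally show ?thesis .
  qed
  have 1: "\<sigma> * (1/2) ^ Suc j < d" unfolding j_def by (rule LeastI[of _ m]) (rule ex)
  have "d \<le> \<sigma> * (1/2) ^ j"
  proof (cases j)
    case 0 then show ?thesis using assms by simp
  next
    case (Suc i)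
    then have "\<not> \<sigma> * (1/2) ^ Suc i < d" using not_less_Least[of i "\<lambda>i. \<sigma> * (1/2) ^ Suc i < d"] j_def by simp
    then show ?thesis using Suc by simp
  qed
  with 1 that show ?thesis by blast
qed

lemma dyadic_shell_above:
  fixes d \<sigma> :: real
  assumes "0 < \<sigma>" "\<sigma> < d"
  obtains j :: nat where "\<sigma> * 2 ^ j < d" "d \<le> \<sigma> * 2 ^ Suc j"
proof -
  have "0 < d" using assms by simp
  obtain m where m: "d / \<sigma> < 2 ^ m" using real_arch_pow[of 2 "d / \<sigma>"] by auto
  define j where "j = (LEAST i. d \<le> \<sigma> * 2 ^ Suc i)"
  have ex: "d \<le> \<sigma> * 2 ^ Suc m"
  proof -
    have "d \<le> \<sigma> * 2 ^ m" using m assms by (simp add: field_simps)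
    also have "\<dots> \<le> \<sigma> * 2 ^ Suc m" using assms by simp
    finally show ?thesis .
  qed
  have 1: "d \<le> \<sigma> * 2 ^ Suc j" unfolding j_def by (rule LeastI[of _ m]) (rule ex)
  have "\<sigma> * 2 ^ j < d"
  proof (cases j)
    case 0 then show ?thesis using assms by simp
  next
    case (Suc i)
    then have "\<not> d \<le> \<sigma> * 2 ^ Suc i" using not_less_Least[of i "\<lambda>i. d \<le> \<sigma> * 2 ^ Suc i"] j_def by simp
    then show ?thesis using Suc by simp
  qed
  with 1 that show ?thesis by blast
qed

lemma emeasure_ball_scale:
  fixes x :: "real^'n"
  assumes "0 \<le> r"
  shows "emeasure lborel (ball x r) = ennreal (unit_ball_vol (real CARD('n)) * r ^ CARD('n))"
  using emeasure_ball[of r x] assms by simp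

text \<open>On a dyadic shell the kernel is comparable to a constant, and the shell lies in a ball.  Below
  the scale $\sigma$ the factor \<^const>\<open>near\<close> lowers the singularity to the integrable order $n - 1 + s$;
  above it the kernel alone decays fast enough.  The radii are doubled because the balls are open.\<close>
lemma near_frac_ker_le_dyadic:
  fixes z :: "real^'n"
  assumes s: "0 < s" "s < 1" and \<sigma>: "0 < \<sigma>"
  defines "n \<equiv> real CARD('n)"
  shows "ennreal (near \<sigma> z * frac_ker s z)
    \<le> (\<Sum>j. ennreal ((\<sigma> * (1/2) ^ Suc j) powr (-(n - 1 + s)) / \<sigma>) * indicator (ball 0 (2 * \<sigma> * (1/2) ^ j)) z)
    + (\<Sum>j. ennreal ((\<sigma> * 2 ^ j) powr (-(n + s))) * indicator (ball 0 (2 * \<sigma> * 2 ^ Suc j)) z)"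
proof -
  have n: "1 \<le> n" unfolding n_def by (simp add: Suc_leI)
  let ?f = "\<lambda>j. ennreal ((\<sigma> * (1/2) ^ Suc j) powr (-(n - 1 + s)) / \<sigma>) * indicator (ball 0 (2 * \<sigma> * (1/2) ^ j)) z"
  let ?g = "\<lambda>j. ennreal ((\<sigma> * 2 ^ j) powr (-(n + s))) * indicator (ball 0 (2 * \<sigma> * 2 ^ Suc j)) z"
  have term_le: "f j \<le> (\<Sum>j. f j)" for f :: "nat \<Rightarrow> ennreal" and j
    using sum_le_suminf[OF summableI, of "{j}" f] by simp
  consider "z = 0" | "z \<noteq> 0" "norm z \<le> \<sigma>" | "\<sigma> < norm z" by linarith
  then show ?thesis
  proof cases
    case 1
    then show ?thesis by (simp add: near_def)
  next
    case 2
    then have z: "0 < norm z" by simp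
    obtain j where j: "\<sigma> * (1/2) ^ Suc j < norm z" "norm z \<le> \<sigma> * (1/2) ^ j"
      using dyadic_shell_below[OF z 2(2)] by blast
    have "frac_ker s z = norm z powr (-(n + s))"
      by (simp only: frac_ker_def n_def powr_minus_divide)
    then have "near \<sigma> z * frac_ker s z = norm z * norm z powr (-(n + s)) / \<sigma>"
      using 2 \<sigma> by (simp add: near_def)
    also have "norm z * norm z powr (-(n + s)) = norm z powr (1 + (-(n + s)))"
      using z by (simp only: powr_add powr_one)
    also have "1 + (-(n + s)) = -(n - 1 + s)" by simp
    also have "norm z powr (-(n - 1 + s)) / \<sigma> \<le> (\<sigma> * (1/2) ^ Suc j) powr (-(n - 1 + s)) / \<sigma>"
      using j n s \<sigma> by (intro divide_right_mono powr_mono2') auto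
    finally have "near \<sigma> z * frac_ker s z \<le> (\<sigma> * (1/2) ^ Suc j) powr (-(n - 1 + s)) / \<sigma>" .
    moreover have "norm z < 2 * \<sigma> * (1/2) ^ j" using j(2) z by linarith
    ultimately have "ennreal (near \<sigma> z * frac_ker s z) \<le> ?f j" by (simp add: ennreal_leI)
    also have "\<dots> \<le> (\<Sum>j. ?f j)" by (rule term_le)
    also have "\<dots> \<le> (\<Sum>j. ?f j) + (\<Sum>j. ?g j)" by simp
    finally show ?thesis .
  next
    case 3
    then obtain j where j: "\<sigma> * 2 ^ j < norm z" "norm z \<le> \<sigma> * 2 ^ Suc j"
      using dyadic_shell_above[OF \<sigma> 3] by blast
    have z: "0 < norm z" using 3 \<sigma> by linarith
    have "frac_ker s z = norm z powr (-(n + s))"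
      by (simp only: frac_ker_def n_def powr_minus_divide)
    then have "near \<sigma> z * frac_ker s z = norm z powr (-(n + s))"
      using 3 \<sigma> by (simp add: near_def)
    also have "\<dots> \<le> (\<sigma> * 2 ^ j) powr (-(n + s))"
      using j n s \<sigma> by (intro powr_mono2') auto
    finally have "near \<sigma> z * frac_ker s z \<le> (\<sigma> * 2 ^ j) powr (-(n + s))" .
    moreover have "norm z < 2 * \<sigma> * 2 ^ Suc j" using j(2) z by linarith
    ultimately have "ennreal (near \<sigma> z * frac_ker s z) \<le> ?g j" by (simp add: ennreal_leI)
    also have "\<dots> \<le> (\<Sum>j. ?g j)" by (rule term_le)
    also have "\<dots> \<le> (\<Sum>j. ?f j) + (\<Sum>j. ?g j)" by simp
    finally show ?thesis .
  qed
qed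

lemma nn_integral_add_suminf_indicator:
  assumes [measurable]: "\<And>j. B j \<in> sets M" "\<And>j. C j \<in> sets M"
  shows "(\<integral>\<^sup>+z. (\<Sum>j. b j * indicator (B j) z) + (\<Sum>j. c j * indicator (C j) z) \<partial>M)
    = (\<Sum>j. \<integral>\<^sup>+z. b j * indicator (B j) z \<partial>M) + (\<Sum>j. \<integral>\<^sup>+z. c j * indicator (C j) z \<partial>M)"
proof -
  have *: "(\<integral>\<^sup>+z. (\<Sum>j. b j * indicator (B j) z) \<partial>M) = (\<Sum>j. \<integral>\<^sup>+z. b j * indicator (B j) z \<partial>M)"
    if [measurable]: "\<And>j. B j \<in> sets M" for b :: "nat \<Rightarrow> ennreal" and B
    by (rule nn_integral_suminf) measurable
  have "(\<integral>\<^sup>+z. (\<Sum>j. b j * indicator (B j) z) + (\<Sum>j. c j * indicator (C j) z) \<partial>M)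
    = (\<integral>\<^sup>+z. (\<Sum>j. b j * indicator (B j) z) \<partial>M) + (\<integral>\<^sup>+z. (\<Sum>j. c j * indicator (C j) z) \<partial>M)"
    by (rule nn_integral_add) measurable
  then show ?thesis unfolding *[OF assms(1)] *[OF assms(2)] .
qed

text \<open>The two dyadic series are geometric with ratios $2^{-(1-s)}$ and $2^{-s}$; both converge because
  $0 < s < 1$.  The power $\sigma^{-s}$ is the only one compatible with scaling, and it is what lets
  the estimates below be used at every scale with one constant.\<close>
lemma kernel_integral_bound:
  assumes s: "0 < s" "s < 1"
  obtains J where "0 < J"
    "\<And>\<sigma>. 0 < \<sigma> \<Longrightarrow> (\<integral>\<^sup>+z. ennreal (near \<sigma> z * frac_ker s z) \<partial>(lborel :: (real^'n::finite) measure))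
        \<le> ennreal (J * \<sigma> powr (-s))"
proof -
  define N where "N = CARD('n)"
  define n where "n = real N"
  define V where "V = unit_ball_vol n"
  have n: "1 \<le> n" unfolding n_def N_def by (simp add: Suc_leI)
  have V: "0 < V" unfolding V_def using n by simp
  define a where "a = V * 2 powr (n + (n - 1 + s))"
  define b where "b = V * 2 powr (2 * n)"
  define q where "q = (1/2::real) powr (1 - s)"
  define q' where "q' = (1/2::real) powr s"
  have q: "0 \<le> q" "q < 1" "0 \<le> q'" "q' < 1"
    using s powr_less_mono2[of "1 - s" "1/2" 1] powr_less_mono2[of s "1/2" 1] by (auto simp: q_def q'_def)
  define J where "J = a / (1 - q) + b / (1 - q')"
  have ab: "0 < a" "0 < b" using V by (auto simp: a_def b_def)
  have Jpos: "0 < J" unfolding J_def using ab q by (intro add_pos_pos divide_pos_pos) auto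
  have "(\<integral>\<^sup>+z. ennreal (near \<sigma> z * frac_ker s z) \<partial>(lborel :: (real^'n) measure)) \<le> ennreal (J * \<sigma> powr (-s))"
    if \<sigma>: "0 < \<sigma>" for \<sigma>
  proof -
    let ?f = "\<lambda>j z. ennreal ((\<sigma> * (1/2) ^ Suc j) powr (-(n - 1 + s)) / \<sigma>) * indicator (ball (0::real^'n) (2 * \<sigma> * (1/2) ^ j)) z"
    let ?g = "\<lambda>j z. ennreal ((\<sigma> * 2 ^ j) powr (-(n + s))) * indicator (ball (0::real^'n) (2 * \<sigma> * 2 ^ Suc j)) z"
    have f: "(\<integral>\<^sup>+z. ?f j z \<partial>lborel) = ennreal (a * \<sigma> powr (-s) * q ^ j)" for j
    proof -
      have "(\<integral>\<^sup>+z. ?f j z \<partial>lborel) = ennreal ((\<sigma> * (1/2) ^ Suc j) powr (-(n - 1 + s)) / \<sigma>) * ennreal (V * (2 * \<sigma> * (1/2) ^ j) ^ N)"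
        using \<sigma> by (subst nn_integral_cmult_indicator) (simp_all add: emeasure_ball_scale V_def n_def N_def)
      also have "\<dots> = ennreal ((\<sigma> * (1/2) ^ Suc j) powr (-(n - 1 + s)) / \<sigma> * (V * (2 * \<sigma> * (1/2) ^ j) ^ N))"
        by (rule ennreal_mult'[symmetric]) (use \<sigma> in simp)
      also have "(\<sigma> * (1/2) ^ Suc j) powr (-(n - 1 + s)) / \<sigma> * (V * (2 * \<sigma> * (1/2) ^ j) ^ N) = a * \<sigma> powr (-s) * q ^ j"
      proof -
        \<comment> \<open>Written as exponentials of linear expressions in $\ln \sigma$ and $\ln 2$, both sides can be
          compared exponent by exponent.\<close>
        define L where "L = ln (2::real)"
        have half: "ln (1/2::real) = - L" by (simp add: L_def ln_div)
        have p: "x ^ m = exp (real m * ln x)" if "0 < x" for x :: real and m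
          using that by (simp add: exp_of_nat_mult)
        have lh: "ln (x * (1/2) ^ m) = ln x - real m * L" if "0 < x" for x :: real and m
        proof -
          have "ln (x * (1/2) ^ m) = ln x + ln ((1/2) ^ m)"
            by (rule ln_mult_pos) (use that in auto)
          also have "ln ((1/2::real) ^ m) = real m * ln (1/2)" by (rule ln_realpow)
          finally show ?thesis unfolding half by simp
        qed
        have l1: "ln (\<sigma> * (1/2) ^ Suc j) = ln \<sigma> - real (Suc j) * L" by (rule lh[OF \<sigma>])
        have l2: "ln (2 * \<sigma> * (1/2) ^ j) = L + ln \<sigma> - real j * L"
          using lh[of "2 * \<sigma>" j] ln_mult_pos[of 2 \<sigma>] \<sigma> unfolding L_def by simp
        have t1: "(\<sigma> * (1/2) ^ Suc j) powr (-(n - 1 + s)) = exp (-(n - 1 + s) * (ln \<sigma> - real (Suc j) * L))"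
          unfolding powr_def l1[symmetric] using \<sigma> by simp
        have t2: "(2 * \<sigma> * (1/2) ^ j) ^ N = exp (n * (L + ln \<sigma> - real j * L))"
          unfolding l2[symmetric] n_def using \<sigma> by (intro p) simp
        have t3: "q ^ j = exp (real j * ((1 - s) * (- L)))"
        proof -
          have "q = exp ((1 - s) * (- L))" unfolding q_def powr_def half by simp
          then show ?thesis by (simp only: exp_of_nat_mult)
        qed
        have t4: "1 / \<sigma> = exp (- ln \<sigma>)" using \<sigma> by (simp add: exp_minus inverse_eq_divide)
        have "(\<sigma> * (1/2) ^ Suc j) powr (-(n - 1 + s)) / \<sigma> * (V * (2 * \<sigma> * (1/2) ^ j) ^ N)
            = V * (exp (-(n - 1 + s) * (ln \<sigma> - real (Suc j) * L)) * exp (- ln \<sigma>) * exp (n * (L + ln \<sigma> - real j * L)))"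
          unfolding t1 t2 t4[symmetric] by simp
        also have "\<dots> = V * (exp ((n + (n - 1 + s)) * L) * exp (- s * ln \<sigma>) * exp (real j * ((1 - s) * (- L))))"
        proof -
          have "-(n - 1 + s) * (ln \<sigma> - real (Suc j) * L) + - ln \<sigma> + n * (L + ln \<sigma> - real j * L)
              = (n + (n - 1 + s)) * L + - s * ln \<sigma> + real j * ((1 - s) * (- L))"
            by (simp add: algebra_simps)
          then show ?thesis by (simp only: exp_add[symmetric])
        qed
        also have "\<dots> = a * \<sigma> powr (-s) * q ^ j"
          unfolding t3 a_def powr_def L_def using \<sigma> by simp
        finally show ?thesis .
      qed
      finally show ?thesis .
    qed
    have g: "(\<integral>\<^sup>+z. ?g j z \<partial>lborel) = ennreal (b * \<sigma> powr (-s) * q' ^ j)" for j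
    proof -
      have "(\<integral>\<^sup>+z. ?g j z \<partial>lborel) = ennreal ((\<sigma> * 2 ^ j) powr (-(n + s))) * ennreal (V * (2 * \<sigma> * 2 ^ Suc j) ^ N)"
        using \<sigma> by (subst nn_integral_cmult_indicator) (simp_all add: emeasure_ball_scale V_def n_def N_def)
      also have "\<dots> = ennreal ((\<sigma> * 2 ^ j) powr (-(n + s)) * (V * (2 * \<sigma> * 2 ^ Suc j) ^ N))"
        by (rule ennreal_mult'[symmetric]) (use \<sigma> in simp)
      also have "(\<sigma> * 2 ^ j) powr (-(n + s)) * (V * (2 * \<sigma> * 2 ^ Suc j) ^ N) = b * \<sigma> powr (-s) * q' ^ j"
      proof -
        define L where "L = ln (2::real)"
        have half: "ln (1/2::real) = - L" by (simp add: L_def ln_div)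
        have p: "x ^ m = exp (real m * ln x)" if "0 < x" for x :: real and m
          using that by (simp add: exp_of_nat_mult)
        have lt: "ln (x * 2 ^ m) = ln x + real m * L" if "0 < x" for x :: real and m
        proof -
          have "ln (x * 2 ^ m) = ln x + ln (2 ^ m)"
            by (rule ln_mult_pos) (use that in auto)
          also have "ln ((2::real) ^ m) = real m * ln 2" by (rule ln_realpow)
          finally show ?thesis by (simp add: L_def)
        qed
        have l1: "ln (\<sigma> * 2 ^ j) = ln \<sigma> + real j * L" by (rule lt[OF \<sigma>])
        have l2: "ln (2 * \<sigma> * 2 ^ Suc j) = L + ln \<sigma> + real (Suc j) * L"
          using lt[of "2 * \<sigma>" "Suc j"] ln_mult_pos[of 2 \<sigma>] \<sigma> unfolding L_def by simp
        have t1: "(\<sigma> * 2 ^ j) powr (-(n + s)) = exp (-(n + s) * (ln \<sigma> + real j * L))"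
          unfolding powr_def l1[symmetric] using \<sigma> by simp
        have t2: "(2 * \<sigma> * 2 ^ Suc j) ^ N = exp (n * (L + ln \<sigma> + real (Suc j) * L))"
          unfolding l2[symmetric] n_def using \<sigma> by (intro p) simp
        have t3: "q' ^ j = exp (real j * (s * (- L)))"
        proof -
          have "q' = exp (s * (- L))" unfolding q'_def powr_def half by simp
          then show ?thesis by (simp only: exp_of_nat_mult)
        qed
        have "(\<sigma> * 2 ^ j) powr (-(n + s)) * (V * (2 * \<sigma> * 2 ^ Suc j) ^ N)
            = V * (exp (-(n + s) * (ln \<sigma> + real j * L)) * exp (n * (L + ln \<sigma> + real (Suc j) * L)))"
          unfolding t1 t2 by simp
        also have "\<dots> = V * (exp (2 * n * L) * exp (- s * ln \<sigma>) * exp (real j * (s * (- L))))"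
        proof -
          have "-(n + s) * (ln \<sigma> + real j * L) + n * (L + ln \<sigma> + real (Suc j) * L)
              = 2 * n * L + - s * ln \<sigma> + real j * (s * (- L))"
            by (simp add: algebra_simps)
          then show ?thesis by (simp only: exp_add[symmetric])
        qed
        also have "\<dots> = b * \<sigma> powr (-s) * q' ^ j"
          unfolding t3 b_def powr_def L_def using \<sigma> by simp
        finally show ?thesis .
      qed
      finally show ?thesis .
    qed
    have geo: "(\<Sum>j. ennreal (c * r ^ j)) = ennreal (c / (1 - r))" if "0 \<le> r" "r < 1" "0 \<le> c" for c r :: real
    proof -
      have "(\<lambda>j. c * r ^ j) sums (c * (1 / (1 - r)))"
        by (rule sums_mult[OF geometric_sums]) (use that in simp)
      then have "(\<lambda>j. ennreal (c * r ^ j)) sums ennreal (c * (1 / (1 - r)))"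
        using that by (subst sums_ennreal) simp_all
      from sums_unique[OF this] show ?thesis by simp
    qed
    have "(\<integral>\<^sup>+z. ennreal (near \<sigma> z * frac_ker s z) \<partial>(lborel :: (real^'n) measure))
        \<le> (\<integral>\<^sup>+z. (\<Sum>j. ?f j z) + (\<Sum>j. ?g j z) \<partial>lborel)"
      unfolding n_def N_def by (rule nn_integral_mono) (rule near_frac_ker_le_dyadic[OF s \<sigma>])
    also have "\<dots> = (\<Sum>j. \<integral>\<^sup>+z. ?f j z \<partial>lborel) + (\<Sum>j. \<integral>\<^sup>+z. ?g j z \<partial>lborel)"
      by (rule nn_integral_add_suminf_indicator) simp_all
    also have "\<dots> = ennreal (a * \<sigma> powr (-s) / (1 - q)) + ennreal (b * \<sigma> powr (-s) / (1 - q'))"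
    proof -
      have "0 \<le> a * \<sigma> powr (-s)" "0 \<le> b * \<sigma> powr (-s)" using ab by simp_all
      then show ?thesis unfolding f g using geo q by (simp only:)
    qed
    also have "\<dots> = ennreal (J * \<sigma> powr (-s))"
    proof -
      have "0 \<le> a * \<sigma> powr (-s) / (1 - q)" "0 \<le> b * \<sigma> powr (-s) / (1 - q')"
        using ab q by simp_all
      moreover have "a * \<sigma> powr (-s) / (1 - q) + b * \<sigma> powr (-s) / (1 - q') = J * \<sigma> powr (-s)"
        by (simp add: J_def distrib_right)
      ultimately show ?thesis by (simp only: ennreal_plus[symmetric])
    qed
    finally show ?thesis .
  qed
  with Jpos that show ?thesis by blast
qed

section \<open>Barriers and competitors\<close>

text \<open>A flat bottom, then the square of the distance to the ball $B_\rho$ in units of $\sigma$, capped at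
  height $\sigma$.  The square makes the barrier semiconcave across the sphere of radius $\rho$, and
  the cap preserves semiconcavity.\<close>
definition barrier :: "real \<Rightarrow> real \<Rightarrow> real \<Rightarrow> real^'n \<Rightarrow> real" where
  "barrier k \<rho> \<sigma> x = k + \<sigma> * (min 1 (max 0 (norm x - \<rho>) / \<sigma>))\<^sup>2"

text \<open>The amount that is cut off.  Truncating $u$ at the top of the barrier keeps the cut bounded by
  $\sigma$ and makes it vanish outside $B_{\rho + \sigma}$ however large $u$ is there.\<close>
definition excess :: "(real^'n \<Rightarrow> real) \<Rightarrow> real \<Rightarrow> real \<Rightarrow> real \<Rightarrow> real^'n \<Rightarrow> real" where
  "excess u k \<rho> \<sigma> x = max 0 (min (u x) (k + \<sigma>) - barrier k \<rho> \<sigma> x)"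

lemma borel_measurable_barrier [measurable]: "barrier k \<rho> \<sigma> \<in> borel_measurable borel"
  unfolding barrier_def[abs_def] by measurable

lemma borel_measurable_excess [measurable (raw)]:
  assumes [measurable]: "u \<in> borel_measurable borel"
  shows "excess u k \<rho> \<sigma> \<in> borel_measurable borel"
  unfolding excess_def[abs_def] by measurable

lemma barrier_bounds:
  assumes "0 < \<sigma>" shows "k \<le> barrier k \<rho> \<sigma> x" "barrier k \<rho> \<sigma> x \<le> k + \<sigma>"
proof -
  have "(min 1 (max 0 (norm x - \<rho>) / \<sigma>))\<^sup>2 \<le> 1"
    using assms by (intro power_le_one) auto
  then show "k \<le> barrier k \<rho> \<sigma> x" "barrier k \<rho> \<sigma> x \<le> k + \<sigma>"
    using assms by (simp_all add: barrier_def)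
qed

lemma barrier_inside: "norm x \<le> \<rho> \<Longrightarrow> barrier k \<rho> \<sigma> x = k"
  by (simp add: barrier_def)

lemma barrier_outside: "0 < \<sigma> \<Longrightarrow> \<rho> + \<sigma> \<le> norm x \<Longrightarrow> barrier k \<rho> \<sigma> x = k + \<sigma>"
  by (simp add: barrier_def min_def)

lemma barrier_lipschitz:
  fixes x y :: "real^'n"
  assumes \<sigma>: "0 < \<sigma>"
  shows "\<bar>barrier k \<rho> \<sigma> x - barrier k \<rho> \<sigma> y\<bar> \<le> 2 * \<sigma> * near \<sigma> (x - y)"
proof -
  define a where "a = min 1 (max 0 (norm x - \<rho>) / \<sigma>)"
  define b where "b = min 1 (max 0 (norm y - \<rho>) / \<sigma>)"
  have ab: "0 \<le> a" "a \<le> 1" "0 \<le> b" "b \<le> 1" using \<sigma> by (auto simp: a_def b_def)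
  have "\<bar>max 0 (norm x - \<rho>) - max 0 (norm y - \<rho>)\<bar> \<le> norm (x - y)"
    using norm_triangle_ineq3[of x y] by linarith
  then have "\<bar>max 0 (norm x - \<rho>) / \<sigma> - max 0 (norm y - \<rho>) / \<sigma>\<bar> \<le> norm (x - y) / \<sigma>"
    using \<sigma> by (simp add: diff_divide_distrib[symmetric] divide_right_mono)
  then have "\<bar>a - b\<bar> \<le> norm (x - y) / \<sigma>" unfolding a_def b_def by linarith
  moreover have "\<bar>a - b\<bar> \<le> 1" using ab by linarith
  ultimately have le: "\<bar>a - b\<bar> \<le> near \<sigma> (x - y)" by (simp add: near_def)
  have "\<bar>barrier k \<rho> \<sigma> x - barrier k \<rho> \<sigma> y\<bar> = \<sigma> * (\<bar>a + b\<bar> * \<bar>a - b\<bar>)"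
  proof -
    have "barrier k \<rho> \<sigma> x - barrier k \<rho> \<sigma> y = \<sigma> * ((a + b) * (a - b))"
      unfolding barrier_def a_def[symmetric] b_def[symmetric]
      by (simp add: power2_eq_square algebra_simps)
    then show ?thesis using \<sigma> by (simp only: abs_mult abs_of_pos)
  qed
  also have "\<dots> \<le> \<sigma> * (2 * near \<sigma> (x - y))"
    using ab le \<sigma> by (intro mult_left_mono mult_mono) auto
  finally show ?thesis by simp
qed

lemma barrier_lipschitz_norm:
  fixes x y :: "real^'n"
  assumes \<sigma>: "0 < \<sigma>"
  shows "\<bar>barrier k \<rho> \<sigma> x - barrier k \<rho> \<sigma> y\<bar> \<le> 2 * norm (x - y)"
proof -
  have "\<sigma> * near \<sigma> (x - y) \<le> \<sigma> * (norm (x - y) / \<sigma>)"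
    using \<sigma> by (intro mult_left_mono) (auto simp: near_def)
  then show ?thesis using barrier_lipschitz[OF \<sigma>, of k \<rho> x y] \<sigma> by simp
qed

text \<open>Squared distance to a ball is the minimum of the parabolas $|x - p|^2$ over its points $p$, and
  such a minimum inherits the second-difference bound of the parabolas: compare at $x \pm z$ with
  the parabola that is optimal at $x$.  Where the cap is active, the barrier is at its maximum.\<close>
lemma barrier_semiconcave:
  fixes x z :: "real^'n"
  assumes \<sigma>: "0 < \<sigma>" and \<rho>: "0 < \<rho>"
  shows "barrier k \<rho> \<sigma> (x + z) + barrier k \<rho> \<sigma> (x - z) - 2 * barrier k \<rho> \<sigma> x \<le> 2 * (norm z)\<^sup>2 / \<sigma>"
proof (cases "\<rho> + \<sigma> \<le> norm x")
  case True
  then show ?thesis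
    using barrier_outside[OF \<sigma> True, of k] barrier_bounds(2)[OF \<sigma>, of k \<rho> "x + z"]
      barrier_bounds(2)[OF \<sigma>, of k \<rho> "x - z"] \<sigma> by (smt (verit) divide_nonneg_pos zero_le_power2)
next
  case False
  obtain p where p: "norm p \<le> \<rho>" "norm (x - p) = max 0 (norm x - \<rho>)"
  proof (cases "norm x \<le> \<rho>")
    case True
    then show ?thesis using that[of x] by simp
  next
    case False
    then have x: "0 < norm x" using \<rho> by linarith
    define p where "p = (\<rho> / norm x) *\<^sub>R x"
    have "x - p = (1 - \<rho> / norm x) *\<^sub>R x" by (simp add: p_def scaleR_diff_left)
    then have "norm (x - p) = \<bar>1 - \<rho> / norm x\<bar> * norm x" by simp
    also have "\<dots> = norm x - \<rho>" using False x by (simp add: field_simps abs_if)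
    finally show ?thesis using False x \<rho> by (intro that[of p]) (auto simp: p_def)
  qed
  have upper: "barrier k \<rho> \<sigma> y \<le> k + (norm (y - p))\<^sup>2 / \<sigma>" for y
  proof -
    have "norm y \<le> norm (y - p) + norm p" using norm_triangle_ineq[of "y - p" p] by simp
    then have "max 0 (norm y - \<rho>) \<le> norm (y - p)" using p(1) by auto
    then have "min 1 (max 0 (norm y - \<rho>) / \<sigma>) \<le> norm (y - p) / \<sigma>"
      using \<sigma> by (meson divide_right_mono less_imp_le min.coboundedI2)
    moreover have "0 \<le> min 1 (max 0 (norm y - \<rho>) / \<sigma>)" using \<sigma> by auto
    ultimately have "(min 1 (max 0 (norm y - \<rho>) / \<sigma>))\<^sup>2 \<le> (norm (y - p) / \<sigma>)\<^sup>2"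
      by (intro power_mono) auto
    then have "\<sigma> * (min 1 (max 0 (norm y - \<rho>) / \<sigma>))\<^sup>2 \<le> \<sigma> * (norm (y - p) / \<sigma>)\<^sup>2"
      using \<sigma> by (intro mult_left_mono) auto
    also have "\<dots> = (norm (y - p))\<^sup>2 / \<sigma>" using \<sigma> by (simp add: power2_eq_square)
    finally show ?thesis by (simp add: barrier_def)
  qed
  have "min 1 (max 0 (norm x - \<rho>) / \<sigma>) = norm (x - p) / \<sigma>"
    using False \<sigma> p(2) by (simp add: min_def)
  then have eq: "barrier k \<rho> \<sigma> x = k + (norm (x - p))\<^sup>2 / \<sigma>"
    using \<sigma> by (simp add: barrier_def power2_eq_square)
  have par: "(norm (x + z - p))\<^sup>2 + (norm (x - z - p))\<^sup>2 = 2 * (norm (x - p))\<^sup>2 + 2 * (norm z)\<^sup>2"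
    unfolding power2_norm_eq_inner by (simp add: inner_commute algebra_simps)
  have "barrier k \<rho> \<sigma> (x + z) + barrier k \<rho> \<sigma> (x - z) - 2 * barrier k \<rho> \<sigma> x
      \<le> ((norm (x + z - p))\<^sup>2 + (norm (x - z - p))\<^sup>2 - 2 * (norm (x - p))\<^sup>2) / \<sigma>"
    using upper[of "x + z"] upper[of "x - z"] eq by (simp add: add_divide_distrib diff_divide_distrib)
  also have "\<dots> = 2 * (norm z)\<^sup>2 / \<sigma>" unfolding par by simp
  finally show ?thesis .
qed

lemma excess_nonneg [simp]: "0 \<le> excess u k \<rho> \<sigma> x"
  by (simp add: excess_def)

lemma excess_le:
  assumes "0 < \<sigma>" shows "excess u k \<rho> \<sigma> x \<le> \<sigma>"
  using barrier_bounds[OF assms, of k \<rho> x] assms by (auto simp: excess_def)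

lemma excess_posD:
  assumes "0 < \<sigma>" "0 < excess u k \<rho> \<sigma> x"
  shows "norm x < \<rho> + \<sigma>" "k < u x" "barrier k \<rho> \<sigma> x \<le> u x - excess u k \<rho> \<sigma> x"
proof -
  show "norm x < \<rho> + \<sigma>"
    using assms barrier_outside[OF assms(1), of \<rho> x k] by (force simp: excess_def)
  show "k < u x" using assms barrier_bounds[OF assms(1), of k \<rho> x] by (auto simp: excess_def)
  show "barrier k \<rho> \<sigma> x \<le> u x - excess u k \<rho> \<sigma> x" using assms(2) by (auto simp: excess_def)
qed

lemma excess_outside: "0 < \<sigma> \<Longrightarrow> \<rho> + \<sigma> \<le> norm x \<Longrightarrow> excess u k \<rho> \<sigma> x = 0"
  using excess_posD(1)[of \<sigma> u k \<rho> x] excess_nonneg[of u k \<rho> \<sigma> x] by linarith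

lemma excess_inside: "0 < \<sigma> \<Longrightarrow> norm x \<le> \<rho> \<Longrightarrow> k + \<sigma> \<le> u x \<Longrightarrow> excess u k \<rho> \<sigma> x = \<sigma>"
  by (simp add: excess_def barrier_inside min_def)

lemma excess_diff_le:
  "\<bar>excess u k \<rho> \<sigma> x - excess u k \<rho> \<sigma> y\<bar> \<le> \<bar>u x - u y\<bar> + \<bar>barrier k \<rho> \<sigma> x - barrier k \<rho> \<sigma> y\<bar>"
  unfolding excess_def by linarith

text \<open>As a function of the value of $u$ and the value of the barrier, the competitor is nondecreasing
  with slope at most $1$ in the former and $1$-Lipschitz in the latter.\<close>
lemma competitor_diff_le:
  "\<bar>(u x - excess u k \<rho> \<sigma> x) - (u y - excess u k \<rho> \<sigma> y)\<bar>
    \<le> \<bar>u x - u y\<bar> + \<bar>barrier k \<rho> \<sigma> x - barrier k \<rho> \<sigma> y\<bar>"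
  unfolding excess_def by linarith

definition energy_gap :: "real \<Rightarrow> (real^'n \<Rightarrow> real) \<Rightarrow> (real^'n \<Rightarrow> real) \<Rightarrow> real^'n \<Rightarrow> real^'n \<Rightarrow> real" where
  "energy_gap s u v x y =
    (GG_int CARD('n) s ((u x - u y) / norm (x - y)) - GG_int CARD('n) s ((v x - v y) / norm (x - y)))
      * (1 / norm (x - y) powr (real CARD('n) - 1 + s))"

lemma frac_ker_eq:
  "frac_ker s z = 1 / norm z * (1 / norm (z :: real^'n) powr (real CARD('n) - 1 + s))"
proof (cases "z = 0")
  case False
  then have "norm z powr (real CARD('n) + s) = norm z powr 1 * norm z powr (real CARD('n) - 1 + s)"
    by (subst powr_add[symmetric]) simp
  with False show ?thesis by (simp add: frac_ker_def)
qed (simp add: frac_ker_def)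

lemma energy_gap_geI:
  fixes x y :: "real^'n"
  assumes "x \<noteq> y \<Longrightarrow> r \<le> norm (x - y) *
    (GG_int CARD('n) s ((u x - u y) / norm (x - y)) - GG_int CARD('n) s ((v x - v y) / norm (x - y)))"
  shows "r * frac_ker s (x - y) \<le> energy_gap s u v x y"
proof (cases "x = y")
  case False
  let ?D = "GG_int CARD('n) s ((u x - u y) / norm (x - y)) - GG_int CARD('n) s ((v x - v y) / norm (x - y))"
  have "r / norm (x - y) \<le> ?D" using assms False by (simp add: field_simps)
  then have "r / norm (x - y) * (1 / norm (x - y) powr (real CARD('n) - 1 + s))
      \<le> ?D * (1 / norm (x - y) powr (real CARD('n) - 1 + s))"
    by (intro mult_right_mono) auto
  then show ?thesis by (simp add: energy_gap_def frac_ker_eq)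
qed (simp add: energy_gap_def frac_ker_def)

lemma abs_energy_gap_le:
  fixes x y :: "real^'n"
  assumes "0 < s"
  shows "\<bar>energy_gap s u (\<lambda>x. u x - w x) x y\<bar> \<le> 2 * \<bar>w x - w y\<bar> * frac_ker s (x - y)"
proof -
  have "\<bar>GG_int CARD('n) s ((u x - u y) / norm (x - y)) - GG_int CARD('n) s ((u x - w x - (u y - w y)) / norm (x - y))\<bar>
     \<le> 2 * \<bar>(u x - u y) / norm (x - y) - (u x - w x - (u y - w y)) / norm (x - y)\<bar>"
    using assms by (intro GG_int_lipschitz) (auto simp: Suc_leI)
  also have "\<dots> = 2 * \<bar>w x - w y\<bar> / norm (x - y)"
    by (simp add: diff_divide_distrib[symmetric])
  finally have "\<bar>GG_int CARD('n) s ((u x - u y) / norm (x - y)) - GG_int CARD('n) s ((u x - w x - (u y - w y)) / norm (x - y))\<bar>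
      * (1 / norm (x - y) powr (real CARD('n) - 1 + s))
    \<le> 2 * \<bar>w x - w y\<bar> / norm (x - y) * (1 / norm (x - y) powr (real CARD('n) - 1 + s))"
    by (intro mult_right_mono) auto
  then show ?thesis
    unfolding energy_gap_def frac_ker_eq abs_mult by simp
qed

text \<open>The pairwise estimate for unbounded $u$.  When $y$ lies a full $\sigma$ below the level, the quotient
  of the competitor is still at least $1$, and convexity turns the removed amount $w(x)$ into a
  gain.  In all other pairs the competitor can be steeper than $u$ only by the variation of the
  barrier, which is paid for on the set where something was cut.\<close>
lemma energy_gap_gain:
  fixes x y :: "real^'n" and u :: "real^'n \<Rightarrow> real" and k \<rho> \<sigma> :: real
  assumes s: "0 < s" and \<sigma>: "0 < \<sigma>"
  defines "w \<equiv> excess u k \<rho> \<sigma>"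
  shows "g_dens CARD('n) s 3 * (w x * of_bool (u y \<le> k - \<sigma> \<and> norm (x - y) \<le> \<sigma>)) * frac_ker s (x - y)
     \<le> energy_gap s u (\<lambda>x. u x - w x) x y
       + 4 * \<sigma> * (of_bool (0 < w x) + of_bool (0 < w y)) * (near \<sigma> (x - y) * frac_ker s (x - y))"
proof -
  let ?n = "CARD('n)"
  have n: "1 \<le> ?n" by (simp add: Suc_leI)
  define I where "I = (of_bool (0 < w x) + of_bool (0 < w y) :: real)"
  define c where "c = g_dens ?n s 3"
  define gain where "gain = w x * of_bool (u y \<le> k - \<sigma> \<and> norm (x - y) \<le> \<sigma>)"
  have I: "0 \<le> I" by (simp add: I_def)
  have near: "0 \<le> near \<sigma> (x - y)" using near_nonneg[OF \<sigma>] .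
  have w: "0 \<le> w x" "0 \<le> w y" by (auto simp: w_def)
  have gain0: "0 \<le> gain" using w by (simp add: gain_def)
  have "(c * gain - 4 * \<sigma> * I * near \<sigma> (x - y)) * frac_ker s (x - y) \<le> energy_gap s u (\<lambda>x. u x - w x) x y"
  proof (rule energy_gap_geI)
    assume "x \<noteq> y"
    define d where "d = norm (x - y)"
    have d: "0 < d" using \<open>x \<noteq> y\<close> by (simp add: d_def)
    define a where "a = (u x - u y) / d"
    define b where "b = (u x - w x - (u y - w y)) / d"
    have "c * gain - 4 * \<sigma> * I * near \<sigma> (x - y) \<le> d * (GG_int ?n s a - GG_int ?n s b)"
    proof (cases "0 < gain")
      case True
      then have wx: "0 < w x" and uy: "u y \<le> k - \<sigma>" and d\<sigma>: "d \<le> \<sigma>" and g: "gain = w x"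
        using w by (auto simp: gain_def d_def zero_less_mult_iff split: if_splits)
      have wy: "w y = 0"
      proof (rule ccontr)
        assume "w y \<noteq> 0"
        then have "k < u y" using w(2) excess_posD(2)[OF \<sigma>, of u k \<rho> y] unfolding w_def by linarith
        then show False using uy \<sigma> by linarith
      qed
      have "k \<le> u x - w x"
        using excess_posD(3)[OF \<sigma>, of u k \<rho> x] wx barrier_bounds(1)[OF \<sigma>, of k \<rho> x] unfolding w_def by linarith
      then have "d \<le> u x - w x - (u y - w y)" using uy wy d\<sigma> by linarith
      then have "1 \<le> b" using d by (simp add: b_def)
      then have "c \<le> G_int ?n s b" using G_int_step[OF s, of 0 b ?n] by (simp add: c_def)
      then have "c * w x \<le> G_int ?n s b * w x" using wx by (intro mult_right_mono) auto
      also have "\<dots> = d * (G_int ?n s b * (a - b))"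
        using d wy by (simp add: a_def b_def field_simps)
      also have "\<dots> \<le> d * (GG_int ?n s a - GG_int ?n s b)"
        using d by (intro mult_left_mono GG_int_convex) auto
      finally have "c * gain \<le> d * (GG_int ?n s a - GG_int ?n s b)" by (simp add: g)
      moreover have "0 \<le> 4 * \<sigma> * I * near \<sigma> (x - y)" using \<sigma> I near by simp
      ultimately show ?thesis by linarith
    next
      case False
      then have g: "gain = 0" using gain0 by linarith
      show ?thesis
      proof (cases "I = 0")
        case True
        then have "w x = 0" "w y = 0" using w by (auto simp: I_def of_bool_def split: if_splits)
        then show ?thesis using True g by (simp add: a_def b_def)
      next
        case False
        then have I1: "1 \<le> I" by (auto simp: I_def of_bool_def split: if_splits)
        define D where "D = 2 * \<sigma> * near \<sigma> (x - y)"
        have D: "0 \<le> D" using \<sigma> near by (simp add: D_def)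
        have "\<bar>u x - w x - (u y - w y)\<bar> \<le> \<bar>u x - u y\<bar> + D"
          using competitor_diff_le[of u x k \<rho> \<sigma> y] barrier_lipschitz[OF \<sigma>, of k \<rho> x y]
          unfolding w_def D_def by linarith
        then have "\<bar>b\<bar> \<le> \<bar>a\<bar> + D / d"
          using d by (simp add: a_def b_def abs_divide add_divide_distrib[symmetric] divide_right_mono)
        also have "\<dots> = \<bar>\<bar>a\<bar> + D / d\<bar>" using D d by simp
        finally have "GG_int ?n s b \<le> GG_int ?n s (\<bar>a\<bar> + D / d)" by (rule GG_int_abs_mono)
        also have "\<dots> \<le> GG_int ?n s \<bar>a\<bar> + 2 * (D / d)"
          using GG_int_lipschitz[OF s n, of "\<bar>a\<bar> + D / d" "\<bar>a\<bar>"] D d by simp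
        also have "GG_int ?n s \<bar>a\<bar> = GG_int ?n s a" by (cases "0 \<le> a") (auto simp: GG_int_even)
        finally have "- (2 * (D / d)) \<le> GG_int ?n s a - GG_int ?n s b" by simp
        then have "d * - (2 * (D / d)) \<le> d * (GG_int ?n s a - GG_int ?n s b)"
          using d by (intro mult_left_mono) auto
        moreover have "d * - (2 * (D / d)) = - (2 * D)" using d by simp
        moreover have "2 * D * 1 \<le> 2 * D * I" using I1 D by (intro mult_left_mono) auto
        moreover have "4 * \<sigma> * I * near \<sigma> (x - y) = 2 * D * I" "c * gain = 0"
          using g by (simp_all add: D_def)
        ultimately show ?thesis by linarith
      qed
    qed
    then show "c * gain - 4 * \<sigma> * I * near \<sigma> (x - y) \<le> norm (x - y) *
        (GG_int ?n s ((u x - u y) / norm (x - y)) - GG_int ?n s ((u x - w x - (u y - w y)) / norm (x - y)))"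
      by (simp add: a_def b_def d_def)
  qed
  then show ?thesis
    unfolding c_def gain_def I_def by (simp add: algebra_simps)
qed

text \<open>The integrand of the nonlocal mean curvature of the barrier; it depends only on differences, so
  the level $k$ can be dropped.\<close>
definition barrier_slope :: "real \<Rightarrow> real \<Rightarrow> real \<Rightarrow> real^'n \<Rightarrow> real^'n \<Rightarrow> real" where
  "barrier_slope s \<rho> \<sigma> x y = G_int CARD('n) s ((barrier 0 \<rho> \<sigma> x - barrier 0 \<rho> \<sigma> y) / norm (x - y))"

lemma barrier_shift: "barrier k \<rho> \<sigma> x = k + barrier 0 \<rho> \<sigma> x"
  by (simp add: barrier_def)

lemma abs_barrier_slope_le:
  fixes x y :: "real^'n"
  assumes "0 < s" shows "\<bar>barrier_slope s \<rho> \<sigma> x y\<bar> \<le> 2"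
  unfolding barrier_slope_def using assms by (intro abs_G_int_le_2) (auto simp: Suc_leI)

lemma barrier_slope_antisym: "barrier_slope s \<rho> \<sigma> y x = - barrier_slope s \<rho> \<sigma> x y"
proof -
  have "(barrier 0 \<rho> \<sigma> y - barrier 0 \<rho> \<sigma> x) / norm (y - x)
      = - ((barrier 0 \<rho> \<sigma> x - barrier 0 \<rho> \<sigma> y) / norm (x - y))"
    by (simp only: norm_minus_commute[of y x] minus_divide_left minus_diff_eq)
  then show ?thesis unfolding barrier_slope_def by (simp only: G_int_odd)
qed

lemma borel_measurable_barrier_slope [measurable (raw)]:
  assumes [measurable]: "f \<in> borel_measurable M" "g \<in> borel_measurable M"
  shows "(\<lambda>p. barrier_slope s \<rho> \<sigma> (f p) (g p :: real^'n)) \<in> borel_measurable M"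
proof -
  have n: "(\<lambda>p. norm (f p - g p)) \<in> borel_measurable M" by measurable
  have "(\<lambda>p. barrier 0 \<rho> \<sigma> (f p)) \<in> borel_measurable M" "(\<lambda>p. barrier 0 \<rho> \<sigma> (g p)) \<in> borel_measurable M"
    by (rule measurable_compose[OF _ borel_measurable_barrier], fact)+
  then have "(\<lambda>p. (barrier 0 \<rho> \<sigma> (f p) - barrier 0 \<rho> \<sigma> (g p)) / norm (f p - g p)) \<in> borel_measurable M"
    using n by (intro borel_measurable_divide borel_measurable_diff)
  from measurable_compose[OF this borel_measurable_G_int] show ?thesis
    unfolding barrier_slope_def .
qed

text \<open>The quotients in the opposite directions $z$ and $-z$ add up to a second difference, which is
  bounded by semiconcavity, and $G_s$ is odd, increasing and $1$-Lipschitz.  So the singularity of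
  the curvature integral is weakened by one order after symmetrisation, which makes it integrable.\<close>
lemma barrier_slope_reflection:
  fixes x z :: "real^'n"
  assumes s: "0 < s" and \<sigma>: "0 < \<sigma>" and \<rho>: "0 < \<rho>"
  shows "- (4 * near \<sigma> z) \<le> barrier_slope s \<rho> \<sigma> x (x + z) + barrier_slope s \<rho> \<sigma> x (x - z)"
proof (cases "z = 0")
  case True
  then show ?thesis by (simp add: barrier_slope_def near_def)
next
  case False
  let ?G = "G_int CARD('n) s"
  define b where "b = (barrier 0 \<rho> \<sigma> x - barrier 0 \<rho> \<sigma> (x + z)) / norm z"
  define b' where "b' = (barrier 0 \<rho> \<sigma> x - barrier 0 \<rho> \<sigma> (x - z)) / norm z"
  have eq: "barrier_slope s \<rho> \<sigma> x (x + z) = ?G b" "barrier_slope s \<rho> \<sigma> x (x - z) = ?G b'"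
    by (simp_all add: barrier_slope_def b_def b'_def)
  have "(barrier 0 \<rho> \<sigma> (x + z) + barrier 0 \<rho> \<sigma> (x - z) - 2 * barrier 0 \<rho> \<sigma> x) / norm z
      \<le> 2 * (norm z)\<^sup>2 / \<sigma> / norm z"
    by (intro divide_right_mono barrier_semiconcave \<sigma> \<rho>) simp
  also have "\<dots> = 2 * norm z / \<sigma>" using False by (simp add: power2_eq_square)
  finally have "- (2 * norm z / \<sigma>) \<le> b + b'"
    by (simp add: b_def b'_def diff_divide_distrib add_divide_distrib)
  then have le: "- b' - 2 * norm z / \<sigma> \<le> b" by simp
  have "?G (- b' - 2 * norm z / \<sigma>) \<le> ?G b" by (rule G_int_mono[OF le])
  moreover have "?G (- b') - ?G (- b' - 2 * norm z / \<sigma>) \<le> 2 * norm z / \<sigma>"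
    using G_int_lipschitz[OF s, of "- b' - 2 * norm z / \<sigma>" "- b'" "CARD('n)"] \<sigma> by simp
  ultimately have "- (2 * (norm z / \<sigma>)) \<le> ?G b + ?G b'" by (simp add: G_int_odd)
  moreover have "0 \<le> norm z / \<sigma>" using \<sigma> by simp
  moreover have "\<bar>?G b\<bar> \<le> 2" "\<bar>?G b'\<bar> \<le> 2"
    using s by (auto intro!: abs_G_int_le_2 simp: Suc_leI)
  ultimately show ?thesis unfolding eq near_def min_def by (auto simp: abs_le_iff)
qed

text \<open>The pairwise estimate once $u$ is bounded by the top of the barrier near the support of the cut.
  There the competitor is $\min(u, \zeta)$: it touches $\zeta$ where something was cut and lies below $\zeta$
  elsewhere, so its quotient compares with that of $\zeta$ in the direction in which it is multiplied
  by the cut.  The cost has become linear in $w$, up to pairs at distance more than $\sigma$.\<close>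
lemma energy_gap_gain_bounded:
  fixes x y :: "real^'n" and u :: "real^'n \<Rightarrow> real" and k \<rho> \<sigma> :: real
  assumes s: "0 < s" and \<sigma>: "0 < \<sigma>"
    and bx: "norm x < \<rho> + 2 * \<sigma> \<Longrightarrow> u x \<le> k + \<sigma>" and by': "norm y < \<rho> + 2 * \<sigma> \<Longrightarrow> u y \<le> k + \<sigma>"
  defines "w \<equiv> excess u k \<rho> \<sigma>"
  shows "g_dens CARD('n) s 3 * (w x * of_bool (u y \<le> k - \<sigma> \<and> norm (x - y) \<le> \<sigma>)) * frac_ker s (x - y)
     \<le> energy_gap s u (\<lambda>x. u x - w x) x y
       - barrier_slope s \<rho> \<sigma> x y * (w x - w y) * frac_ker s (x - y)
       + 4 * (w x + w y) * (near \<sigma> (x - y) * frac_ker s (x - y))"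
proof -
  let ?n = "CARD('n)" and ?G = "G_int CARD('n) s"
  define c where "c = g_dens ?n s 3"
  define F where "F = barrier_slope s \<rho> \<sigma> x y"
  define gain where "gain = w x * of_bool (u y \<le> k - \<sigma> \<and> norm (x - y) \<le> \<sigma>)"
  have near: "0 \<le> near \<sigma> (x - y)" using near_nonneg[OF \<sigma>] .
  have w: "0 \<le> w x" "0 \<le> w y" by (auto simp: w_def)
  have gain0: "0 \<le> gain" using w by (simp add: gain_def)
  have F2: "\<bar>F\<bar> \<le> 2" unfolding F_def by (rule abs_barrier_slope_le[OF s])
  have c: "0 < c" by (simp add: c_def g_dens_pos)
  have "(c * gain + F * (w x - w y) - 4 * (w x + w y) * near \<sigma> (x - y)) * frac_ker s (x - y)
      \<le> energy_gap s u (\<lambda>x. u x - w x) x y"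
  proof (rule energy_gap_geI)
    assume "x \<noteq> y"
    define d where "d = norm (x - y)"
    have d: "0 < d" using \<open>x \<noteq> y\<close> by (simp add: d_def)
    define a where "a = (u x - u y) / d"
    define b where "b = (u x - w x - (u y - w y)) / d"
    define e where "e = (barrier k \<rho> \<sigma> x - barrier k \<rho> \<sigma> y) / d"
    have Fe: "F = ?G e" by (simp add: F_def barrier_slope_def e_def d_def barrier_shift[of k])
    have e2: "\<bar>e\<bar> \<le> 2"
    proof -
      have "\<bar>barrier k \<rho> \<sigma> x - barrier k \<rho> \<sigma> y\<bar> / d \<le> 2"
        using barrier_lipschitz_norm[OF \<sigma>, of k \<rho> x y] d by (simp only: pos_divide_le_eq d_def)
      then show ?thesis using d by (simp add: e_def abs_divide)
    qed
    have G2: "\<bar>?G b\<bar> \<le> 2" using s by (intro abs_G_int_le_2) (auto simp: Suc_leI)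
    have "?G b * (w x - w y) = d * (?G b * (a - b))"
      using d by (simp add: a_def b_def field_simps)
    also have "\<dots> \<le> d * (GG_int ?n s a - GG_int ?n s b)"
      using d by (intro mult_left_mono GG_int_convex) auto
    finally have conv: "?G b * (w x - w y) \<le> d * (GG_int ?n s a - GG_int ?n s b)" .
    have pos: "0 \<le> 4 * (w x + w y) * near \<sigma> (x - y)" using w near by simp
    have posx: "norm x < \<rho> + \<sigma>" "barrier k \<rho> \<sigma> x \<le> u x - w x" if "0 < w x"
      using excess_posD[OF \<sigma>, of u k \<rho> x] that by (auto simp: w_def)
    have posy: "norm y < \<rho> + \<sigma>" "barrier k \<rho> \<sigma> y \<le> u y - w y" if "0 < w y"
      using excess_posD[OF \<sigma>, of u k \<rho> y] that by (auto simp: w_def)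
    have upx: "u x - w x \<le> barrier k \<rho> \<sigma> x" if "norm x < \<rho> + 2 * \<sigma>"
      using bx[OF that] by (simp add: w_def excess_def)
    have upy: "u y - w y \<le> barrier k \<rho> \<sigma> y" if "norm y < \<rho> + 2 * \<sigma>"
      using by'[OF that] by (simp add: w_def excess_def)
    have far: "near \<sigma> (x - y) = 1" "\<sigma> < norm (x - y)"
      if "norm x < \<rho> + \<sigma> \<and> \<rho> + 2 * \<sigma> \<le> norm y \<or> norm y < \<rho> + \<sigma> \<and> \<rho> + 2 * \<sigma> \<le> norm x"
    proof -
      show "\<sigma> < norm (x - y)" using that norm_triangle_ineq3[of x y] by linarith
      then show "near \<sigma> (x - y) = 1" using \<sigma> by (simp add: near_def)
    qed
    have main: "c * gain + F * (w x - w y) - 4 * (w x + w y) * near \<sigma> (x - y) \<le> ?G b * (w x - w y)"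
    proof -
      consider (0) "w x = 0" "w y = 0" | (x) "0 < w x" "w y = 0" | (y) "w x = 0" "0 < w y"
        | (xy) "0 < w x" "0 < w y" using w by linarith
      then show ?thesis
      proof cases
        case 0
        then show ?thesis by (simp add: gain_def)
      next
        case x
        show ?thesis
        proof (cases "norm y < \<rho> + 2 * \<sigma>")
          case True
          have "e \<le> b" unfolding e_def b_def
            using d posx[OF x(1)] upy[OF True] by (intro divide_right_mono) linarith+
          then have "F \<le> ?G b" unfolding Fe by (rule G_int_mono)
          have "c * gain + F * w x \<le> ?G b * w x"
          proof (cases "0 < gain")
            case gain: True
            then have uy: "u y \<le> k - \<sigma>" and d\<sigma>: "d \<le> \<sigma>" and g: "gain = w x"
              using w by (auto simp: gain_def d_def zero_less_mult_iff split: if_splits)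
            have "barrier k \<rho> \<sigma> x - barrier k \<rho> \<sigma> y + d \<le> u x - w x - (u y - w y)"
              using uy d\<sigma> x posx(2)[OF x(1)] barrier_bounds(1)[OF \<sigma>, of k \<rho> y] by linarith
            then have "(barrier k \<rho> \<sigma> x - barrier k \<rho> \<sigma> y + d) / d \<le> b"
              unfolding b_def using d by (intro divide_right_mono) auto
            then have "e + 1 \<le> b" using d by (simp add: e_def add_divide_distrib)
            from G_int_step[OF s e2 this, of ?n] have "F + c \<le> ?G b" by (simp add: Fe c_def)
            then have "(F + c) * w x \<le> ?G b * w x" using x by (intro mult_right_mono) auto
            then show ?thesis by (simp add: g algebra_simps)
          next
            case False
            then have "gain = 0" using gain0 by linarith
            then show ?thesis using \<open>F \<le> ?G b\<close> x by (simp add: mult_right_mono)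
          qed
          then show ?thesis using pos x by simp
        next
          case False
          then have "near \<sigma> (x - y) = 1" "gain = 0"
            using far posx[OF x(1)] by (auto simp: gain_def)
          moreover have "(F - 4) * w x \<le> ?G b * w x" using F2 G2 x by (intro mult_right_mono) linarith+
          ultimately show ?thesis using x by (simp add: algebra_simps)
        qed
      next
        case y
        then have g: "gain = 0" by (simp add: gain_def)
        show ?thesis
        proof (cases "norm x < \<rho> + 2 * \<sigma>")
          case True
          have "b \<le> e" unfolding e_def b_def
            using d posy[OF y(2)] upx[OF True] by (intro divide_right_mono) linarith+
          then have "?G b \<le> F" unfolding Fe by (rule G_int_mono)
          then have "?G b * w y \<le> F * w y" using y by (intro mult_right_mono) auto
          moreover have "F * (w x - w y) = - (F * w y)" "?G b * (w x - w y) = - (?G b * w y)" "c * gain = 0"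
            using y g by simp_all
          ultimately show ?thesis using pos by linarith
        next
          case False
          then have "near \<sigma> (x - y) = 1" using far posy[OF y(2)] by auto
          moreover have "?G b * w y \<le> (F + 4) * w y" using F2 G2 y by (intro mult_right_mono) linarith+
          ultimately show ?thesis using y g by (simp add: algebra_simps)
        qed
      next
        case xy
        have n: "norm x < \<rho> + 2 * \<sigma>" "norm y < \<rho> + 2 * \<sigma>" using posx posy xy \<sigma> by force+
        have "b = e" unfolding b_def e_def using posx(2) posy(2) upx upy n xy by force
        moreover have "gain = 0"
          using xy excess_posD(2)[OF \<sigma>, of u k \<rho> y] \<sigma> by (auto simp: gain_def w_def)
        ultimately show ?thesis using pos Fe by simp
      qed
    qed
    from order_trans[OF main conv]
    show "c * gain + F * (w x - w y) - 4 * (w x + w y) * near \<sigma> (x - y) \<le> norm (x - y) *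
        (GG_int ?n s ((u x - u y) / norm (x - y)) - GG_int ?n s ((u x - w x - (u y - w y)) / norm (x - y)))"
      by (simp add: a_def b_def d_def)
  qed
  then show ?thesis
    unfolding c_def gain_def F_def by (simp add: algebra_simps)
qed

section \<open>Integrating against the kernel\<close>

lemma nn_integral_lborel_translate:
  fixes f :: "real^'n \<Rightarrow> ennreal"
  assumes [measurable]: "f \<in> borel_measurable borel"
  shows "(\<integral>\<^sup>+y. f (c + y) \<partial>lborel) = (\<integral>\<^sup>+y. f y \<partial>lborel)"
proof -
  have "(\<integral>\<^sup>+y. f y \<partial>lborel) = (\<integral>\<^sup>+y. f y \<partial>distr lborel borel ((+) c))"
    by (simp add: lborel_distr_plus)
  also have "\<dots> = (\<integral>\<^sup>+y. f (c + y) \<partial>lborel)" by (rule nn_integral_distr) auto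
  finally show ?thesis ..
qed

lemma integral_lborel_translate:
  fixes f :: "real^'n \<Rightarrow> real"
  assumes [measurable]: "f \<in> borel_measurable borel"
  shows "(\<integral>y. f (c + y) \<partial>lborel) = (\<integral>y. f y \<partial>lborel)"
proof -
  have "(\<integral>y. f y \<partial>lborel) = (\<integral>y. f y \<partial>distr lborel borel ((+) c))"
    by (simp add: lborel_distr_plus)
  also have "\<dots> = (\<integral>y. f (c + y) \<partial>lborel)" by (rule integral_distr) auto
  finally show ?thesis ..
qed

lemma integrable_lborel_translate:
  fixes f :: "real^'n \<Rightarrow> real"
  assumes "integrable lborel f"
  shows "integrable lborel (\<lambda>y. f (c + y))"
proof -
  have [measurable]: "f \<in> borel_measurable borel" using borel_measurable_integrable[OF assms] by simp
  have "integrable (distr lborel borel ((+) c)) f" using assms by (simp add: lborel_distr_plus)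
  then show ?thesis by (subst (asm) integrable_distr_eq) auto
qed

lemma near_frac_ker_nonneg: "0 < \<sigma> \<Longrightarrow> 0 \<le> near \<sigma> z * frac_ker s z"
  by (simp add: near_nonneg)

text \<open>On the ball the kernel is at least $r^{-n-s}$, and the remaining half of the ball has measure of
  order $r^n$.  The centre, where the kernel takes the default value $0$, is a null set.\<close>
lemma frac_ker_ball_lower_bound:
  fixes x :: "real^'n"
  assumes s: "0 < s" and r: "0 < r" and [measurable]: "E \<in> sets borel"
    and half: "measure lborel (ball x r - E) \<ge> unit_ball_vol (real CARD('n)) / 2 * r ^ CARD('n)"
  shows "ennreal (unit_ball_vol (real CARD('n)) / 2 * r powr (-s))
    \<le> (\<integral>\<^sup>+y. ennreal (frac_ker s (x - y)) * indicator (ball x r - E) y \<partial>lborel)"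
proof -
  define N where "N = CARD('n)"
  define V where "V = unit_ball_vol (real N) / 2"
  have V: "0 \<le> V" by (simp add: V_def)
  have fin: "emeasure lborel (ball x r - E) < \<infinity>"
    by (rule emeasure_bounded_finite) (auto intro: bounded_subset[OF bounded_ball])
  have "V * r powr (-s) = r powr (-(real N + s)) * (V * r ^ N)"
  proof -
    have "r powr (-s) = r powr (-(real N + s) + real N)" by simp
    also have "\<dots> = r powr (-(real N + s)) * r ^ N" using r by (simp only: powr_add powr_realpow)
    finally show ?thesis by simp
  qed
  also have "\<dots> \<le> r powr (-(real N + s)) * measure lborel (ball x r - E)"
    using half by (intro mult_left_mono) (auto simp: V_def N_def)
  finally have "ennreal (V * r powr (-s)) \<le> ennreal (r powr (-(real N + s))) * emeasure lborel (ball x r - E)"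
    using fin by (simp add: emeasure_eq_ennreal_measure ennreal_mult'[symmetric] ennreal_leI)
  also have "\<dots> = (\<integral>\<^sup>+y. ennreal (r powr (-(real N + s))) * indicator (ball x r - E) y \<partial>lborel)"
    by (subst nn_integral_cmult_indicator) auto
  also have "\<dots> \<le> (\<integral>\<^sup>+y. ennreal (frac_ker s (x - y)) * indicator (ball x r - E) y \<partial>lborel)"
  proof (rule nn_integral_mono_AE)
    have "AE y in lborel. y \<noteq> x" by (rule AE_lborel_singleton)
    then show "AE y in lborel. ennreal (r powr (-(real N + s))) * indicator (ball x r - E) y
        \<le> ennreal (frac_ker s (x - y)) * indicator (ball x r - E) y"
    proof eventually_elim
      case (elim y)
      show ?case
      proof (cases "y \<in> ball x r")
        case True
        then have "norm (x - y) \<le> r" "0 < norm (x - y)" using elim by (auto simp: dist_norm)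
        then have "r powr (-(real N + s)) \<le> norm (x - y) powr (-(real N + s))"
          using s by (intro powr_mono2') auto
        also have "\<dots> = frac_ker s (x - y)" by (simp only: frac_ker_def N_def powr_minus_divide)
        finally show ?thesis by (intro mult_right_mono ennreal_leI) auto
      qed simp
    qed
  qed
  finally show ?thesis unfolding V_def N_def .
qed

lemma weight_integral:
  fixes e :: "real^'n \<Rightarrow> real"
  assumes e: "integrable lborel e" "\<And>x. 0 \<le> e x" and \<sigma>: "0 < \<sigma>" and J: "0 < J"
    and kernel_bound: "(\<integral>\<^sup>+z. ennreal (near \<sigma> z * frac_ker s z) \<partial>(lborel :: (real^'n) measure))
      \<le> ennreal (J * \<sigma> powr (-s))"
  shows "integrable (lborel \<Otimes>\<^sub>M lborel) (\<lambda>(x, y). (e x + e y) * (near \<sigma> (x - y) * frac_ker s (x - y)))"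
    and "(\<integral>(x, y). (e x + e y) * (near \<sigma> (x - y) * frac_ker s (x - y)) \<partial>(lborel \<Otimes>\<^sub>M lborel))
      \<le> 2 * J * \<sigma> powr (-s) * (\<integral>x. e x \<partial>lborel)"
proof -
  have [measurable]: "e \<in> borel_measurable borel" using borel_measurable_integrable[OF e(1)] by simp
  let ?k = "\<lambda>z :: real^'n. near \<sigma> z * frac_ker s z"
  have k0: "0 \<le> ?k z" for z using \<sigma> by (rule near_frac_ker_nonneg)
  have kev: "?k (x - y) = ?k (y - x)" for x y :: "real^'n"
    using frac_ker_minus[of s "y - x"] frac_ker_minus(2)[of \<sigma> "y - x"] by simp
  have inner: "(\<integral>\<^sup>+y. ennreal (?k (x - y)) \<partial>lborel) \<le> ennreal (J * \<sigma> powr (-s))" for x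
  proof -
    have "(\<integral>\<^sup>+y. ennreal (?k (x - y)) \<partial>lborel) = (\<integral>\<^sup>+y. ennreal (?k (- x + y)) \<partial>lborel)"
      by (subst kev) simp
    also have "\<dots> = (\<integral>\<^sup>+z. ennreal (?k z) \<partial>lborel)"
      by (rule nn_integral_lborel_translate[of "\<lambda>z. ennreal (?k z)"]) measurable
    finally show ?thesis using kernel_bound by simp
  qed
  have E: "(\<integral>\<^sup>+x. ennreal (e x) \<partial>lborel) = ennreal (\<integral>x. e x \<partial>lborel)"
    using e by (intro nn_integral_eq_integral) auto
  have half: "(\<integral>\<^sup>+x. \<integral>\<^sup>+y. ennreal (e x) * ennreal (?k (x - y)) \<partial>lborel \<partial>lborel)
      \<le> ennreal (J * \<sigma> powr (-s) * (\<integral>x. e x \<partial>lborel))"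
  proof -
    have "(\<integral>\<^sup>+x. \<integral>\<^sup>+y. ennreal (e x) * ennreal (?k (x - y)) \<partial>lborel \<partial>lborel)
        = (\<integral>\<^sup>+x. ennreal (e x) * (\<integral>\<^sup>+y. ennreal (?k (x - y)) \<partial>lborel) \<partial>lborel)"
      by (intro nn_integral_cong nn_integral_cmult) measurable
    also have "\<dots> \<le> (\<integral>\<^sup>+x. ennreal (e x) * ennreal (J * \<sigma> powr (-s)) \<partial>lborel)"
      by (intro nn_integral_mono mult_left_mono inner) auto
    also have "\<dots> = (\<integral>\<^sup>+x. ennreal (e x) \<partial>lborel) * ennreal (J * \<sigma> powr (-s))"
      by (rule nn_integral_multc) measurable
    also have "\<dots> = ennreal (J * \<sigma> powr (-s) * (\<integral>x. e x \<partial>lborel))"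
      unfolding E using J e(2) by (subst ennreal_mult'[symmetric]) (auto simp: mult.commute)
    finally show ?thesis .
  qed
  have half': "(\<integral>\<^sup>+x. \<integral>\<^sup>+y. ennreal (e y) * ennreal (?k (x - y)) \<partial>lborel \<partial>lborel)
      \<le> ennreal (J * \<sigma> powr (-s) * (\<integral>x. e x \<partial>lborel))"
  proof -
    have "(\<integral>\<^sup>+x. \<integral>\<^sup>+y. ennreal (e y) * ennreal (?k (x - y)) \<partial>lborel \<partial>lborel)
        = (\<integral>\<^sup>+y. \<integral>\<^sup>+x. ennreal (e y) * ennreal (?k (x - y)) \<partial>lborel \<partial>lborel)"
      by (rule lborel_pair.Fubini') measurable
    also have "\<dots> = (\<integral>\<^sup>+y. \<integral>\<^sup>+x. ennreal (e y) * ennreal (?k (y - x)) \<partial>lborel \<partial>lborel)"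
      by (subst kev) simp
    finally show ?thesis using half by simp
  qed
  have "(\<integral>\<^sup>+p. ennreal (case p of (x, y) \<Rightarrow> (e x + e y) * ?k (x - y)) \<partial>(lborel \<Otimes>\<^sub>M lborel))
      = (\<integral>\<^sup>+x. \<integral>\<^sup>+y. ennreal ((e x + e y) * ?k (x - y)) \<partial>lborel \<partial>lborel)"
    by (subst lborel.nn_integral_fst[symmetric]) simp_all
  also have "\<dots> = (\<integral>\<^sup>+x. \<integral>\<^sup>+y. ennreal (e x) * ennreal (?k (x - y)) + ennreal (e y) * ennreal (?k (x - y)) \<partial>lborel \<partial>lborel)"
    using e(2) k0 by (intro nn_integral_cong) (simp add: distrib_right ennreal_mult)
  also have "\<dots> = (\<integral>\<^sup>+x. \<integral>\<^sup>+y. ennreal (e x) * ennreal (?k (x - y)) \<partial>lborel \<partial>lborel)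
      + (\<integral>\<^sup>+x. \<integral>\<^sup>+y. ennreal (e y) * ennreal (?k (x - y)) \<partial>lborel \<partial>lborel)"
    by (subst nn_integral_add, measurable)+
  also have "\<dots> \<le> ennreal (J * \<sigma> powr (-s) * (\<integral>x. e x \<partial>lborel)) + ennreal (J * \<sigma> powr (-s) * (\<integral>x. e x \<partial>lborel))"
    by (intro add_mono half half')
  also have "\<dots> = ennreal (2 * J * \<sigma> powr (-s) * (\<integral>x. e x \<partial>lborel))"
    using J e(2) by (subst ennreal_plus[symmetric]) auto
  finally have le: "(\<integral>\<^sup>+p. ennreal (case p of (x, y) \<Rightarrow> (e x + e y) * ?k (x - y)) \<partial>(lborel \<Otimes>\<^sub>M lborel))
      \<le> ennreal (2 * J * \<sigma> powr (-s) * (\<integral>x. e x \<partial>lborel))" .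
  have pos: "0 \<le> (case p of (x, y) \<Rightarrow> (e x + e y) * ?k (x - y))" for p
    using e(2) k0 by (auto split: prod.split)
  show int: "integrable (lborel \<Otimes>\<^sub>M lborel) (\<lambda>(x, y). (e x + e y) * ?k (x - y))"
  proof (rule integrableI_nonneg)
    show "(\<lambda>(x, y). (e x + e y) * ?k (x - y)) \<in> borel_measurable (lborel \<Otimes>\<^sub>M lborel)" by measurable
    show "(\<integral>\<^sup>+p. ennreal (case p of (x, y) \<Rightarrow> (e x + e y) * ?k (x - y)) \<partial>(lborel \<Otimes>\<^sub>M lborel)) < \<infinity>"
      using le by (rule le_less_trans) simp
  qed (use pos in auto)
  have "ennreal (\<integral>p. (case p of (x, y) \<Rightarrow> (e x + e y) * ?k (x - y)) \<partial>(lborel \<Otimes>\<^sub>M lborel))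
      \<le> ennreal (2 * J * \<sigma> powr (-s) * (\<integral>x. e x \<partial>lborel))"
    using le by (subst (asm) nn_integral_eq_integral[OF int]) (use pos in auto)
  then show "(\<integral>(x, y). (e x + e y) * ?k (x - y) \<partial>(lborel \<Otimes>\<^sub>M lborel)) \<le> 2 * J * \<sigma> powr (-s) * (\<integral>x. e x \<partial>lborel)"
    using J e(2) by (subst (asm) ennreal_le_iff) auto
qed

section \<open>Decay of superlevel sets\<close>

text \<open>All that is used about the solution: it is Borel, and cutting it by \<^const>\<open>excess\<close> at any level
  above $M$ does not lower the energy.  Integrability is part of the interface because only then do
  Bochner integrals carry information.  The smallness of $\epsilon$ states that the gain in balls of
  radius $\epsilon\sigma$ dominates the cost at scale $\sigma$.\<close>
locale truncation_minimiser =
  fixes s J \<epsilon> R M V c :: real and u :: "real^'n \<Rightarrow> real"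
  assumes V: "V = unit_ball_vol (real CARD('n))" and c: "c = g_dens CARD('n) s 3"
    and s: "0 < s" and J: "0 < J" and eps: "0 < \<epsilon>" "\<epsilon> \<le> 1"
    and kernel_bound: "\<And>\<sigma>. 0 < \<sigma> \<Longrightarrow>
      (\<integral>\<^sup>+z. ennreal (near \<sigma> z * frac_ker s z) \<partial>(lborel :: (real^'n) measure)) \<le> ennreal (J * \<sigma> powr (-s))"
    and eps_small: "16 * J * \<epsilon> powr s * 2 ^ CARD('n) \<le> c * V"
    and u_borel [measurable]: "u \<in> borel_measurable borel"
    and excess_diff_integrable: "\<And>k \<rho> \<sigma>. M \<le> k \<Longrightarrow> 0 < \<rho> \<Longrightarrow> 0 < \<sigma> \<Longrightarrow> \<rho> + 2 * \<sigma> \<le> 2 * R \<Longrightarrow>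
      integrable (lborel \<Otimes>\<^sub>M lborel)
        (\<lambda>(x, y). (excess u k \<rho> \<sigma> x - excess u k \<rho> \<sigma> y) * frac_ker s (x - y))"
    and gap_integrable: "\<And>k \<rho> \<sigma>. M \<le> k \<Longrightarrow> 0 < \<rho> \<Longrightarrow> 0 < \<sigma> \<Longrightarrow> \<rho> + 2 * \<sigma> \<le> 2 * R \<Longrightarrow>
      integrable (lborel \<Otimes>\<^sub>M lborel) (\<lambda>(x, y). energy_gap s u (\<lambda>x. u x - excess u k \<rho> \<sigma> x) x y)"
    and gap_nonpos: "\<And>k \<rho> \<sigma>. M \<le> k \<Longrightarrow> 0 < \<rho> \<Longrightarrow> 0 < \<sigma> \<Longrightarrow> \<rho> + 2 * \<sigma> \<le> 2 * R \<Longrightarrow>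
      (\<integral>(x, y). energy_gap s u (\<lambda>x. u x - excess u k \<rho> \<sigma> x) x y \<partial>(lborel \<Otimes>\<^sub>M lborel)) \<le> 0"
begin

lemma V_pos: "0 < V" and c_pos: "0 < c"
  by (simp_all add: V c g_dens_pos)

text \<open>Where $\{u > k - \sigma\}$ is sparse, every point of $S$ sees at least half of a ball of radius
  $\epsilon\sigma$ of low values.\<close>
lemma gain_integral_lower_bound:
  fixes w :: "real^'n \<Rightarrow> real" and S B :: "(real^'n) set"
  assumes [measurable]: "w \<in> borel_measurable borel" "S \<in> sets borel" and w: "\<And>x. 0 \<le> w x"
    and \<sigma>: "0 < \<sigma>" and B: "open B" "bounded B" "\<And>x. x \<in> S \<Longrightarrow> ball x (\<epsilon> * \<sigma>) \<subseteq> B"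
    and few: "measure lborel {y \<in> B. k - \<sigma> < u y} \<le> V / 2 * (\<epsilon> * \<sigma>) ^ CARD('n)"
  shows "ennreal (V / 2 * (\<epsilon> * \<sigma>) powr (-s)) * (\<integral>\<^sup>+x. ennreal (w x) * indicator S x \<partial>lborel)
    \<le> (\<integral>\<^sup>+p. ennreal (case p of (x, y) \<Rightarrow> w x * of_bool (u y \<le> k - \<sigma> \<and> norm (x - y) \<le> \<sigma>) * frac_ker s (x - y))
        \<partial>(lborel \<Otimes>\<^sub>M lborel))"
proof -
  let ?r = "\<epsilon> * \<sigma>"
  have r: "0 < ?r" "?r \<le> \<sigma>" using eps \<sigma> by (auto simp: mult_le_cancel_right1)
  define E where "E = {y. k - \<sigma> < u y}"
  have [measurable]: "E \<in> sets borel" unfolding E_def by measurable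
  have [measurable]: "B \<in> sets borel" using B(1) by simp
  have inner: "ennreal (V / 2 * ?r powr (-s)) * (ennreal (w x) * indicator S x)
      \<le> (\<integral>\<^sup>+y. ennreal (w x * of_bool (u y \<le> k - \<sigma> \<and> norm (x - y) \<le> \<sigma>) * frac_ker s (x - y)) \<partial>lborel)" for x
  proof (cases "x \<in> S")
    case True
    have eq: "ball x ?r - E = ball x ?r - {y \<in> B. k - \<sigma> < u y}" using B(3)[OF True] by (auto simp: E_def)
    have "measure lborel (ball x ?r) = V * ?r ^ CARD('n)"
      using r emeasure_ball_scale[of ?r x] by (simp add: measure_def V)
    moreover have "measure lborel (ball x ?r) \<le> measure lborel (ball x ?r - {y \<in> B. k - \<sigma> < u y}) + measure lborel {y \<in> B. k - \<sigma> < u y}"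
    proof -
      have fin: "X \<in> fmeasurable lborel" if "X \<in> sets borel" "bounded X" for X :: "(real^'n) set"
        using that emeasure_bounded_finite[of X] by (auto intro: fmeasurableI)
      have "{y \<in> B. k - \<sigma> < u y} \<in> fmeasurable lborel" 
        by (rule fin) (use B(2) in \<open>auto intro: bounded_subset\<close>)
      moreover have "ball x ?r - {y \<in> B. k - \<sigma> < u y} \<in> fmeasurable lborel"
        by (rule fin) (auto intro: bounded_subset[OF bounded_ball])
      ultimately have "ball x ?r - {y \<in> B. k - \<sigma> < u y} \<union> {y \<in> B. k - \<sigma> < u y} \<in> fmeasurable lborel"
        by (intro fmeasurable.Un)
      then have "measure lborel (ball x ?r) \<le> measure lborel (ball x ?r - {y \<in> B. k - \<sigma> < u y} \<union> {y \<in> B. k - \<sigma> < u y})"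
        by (intro measure_mono_fmeasurable) auto
      also have "\<dots> \<le> measure lborel (ball x ?r - {y \<in> B. k - \<sigma> < u y}) + measure lborel {y \<in> B. k - \<sigma> < u y}"
        by (rule measure_Un_le) measurable
      finally show ?thesis .
    qed
    ultimately have "V / 2 * ?r ^ CARD('n) \<le> measure lborel (ball x ?r - E)"
      unfolding eq using few by simp
    from frac_ker_ball_lower_bound[OF s r(1) _ this[unfolded V], folded V]
    have "ennreal (V / 2 * ?r powr (-s)) \<le> (\<integral>\<^sup>+y. ennreal (frac_ker s (x - y)) * indicator (ball x ?r - E) y \<partial>lborel)"
      by simp
    have kD: "(\<lambda>y. ennreal (frac_ker s (x - y)) * indicator D y) \<in> borel_measurable lborel"
      if [measurable]: "D \<in> sets borel" for D :: "(real^'n) set" by measurable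
    from \<open>ennreal (V / 2 * ?r powr (-s)) \<le> _\<close> have "ennreal (w x) * ennreal (V / 2 * ?r powr (-s))
        \<le> ennreal (w x) * (\<integral>\<^sup>+y. ennreal (frac_ker s (x - y)) * indicator (ball x ?r - E) y \<partial>lborel)"
      by (intro mult_left_mono) auto
    also have "\<dots> = (\<integral>\<^sup>+y. ennreal (w x) * (ennreal (frac_ker s (x - y)) * indicator (ball x ?r - E) y) \<partial>lborel)"
      by (rule nn_integral_cmult[symmetric, OF kD]) simp
    also have "\<dots> \<le> (\<integral>\<^sup>+y. ennreal (w x * of_bool (u y \<le> k - \<sigma> \<and> norm (x - y) \<le> \<sigma>) * frac_ker s (x - y)) \<partial>lborel)"
    proof (rule nn_integral_mono)
      fix y
      show "ennreal (w x) * (ennreal (frac_ker s (x - y)) * indicator (ball x ?r - E) y)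
          \<le> ennreal (w x * of_bool (u y \<le> k - \<sigma> \<and> norm (x - y) \<le> \<sigma>) * frac_ker s (x - y))"
      proof (cases "y \<in> ball x ?r - E")
        case True
        then have "u y \<le> k - \<sigma> \<and> norm (x - y) \<le> \<sigma>" using r by (auto simp: E_def dist_norm)
        with True show ?thesis using w[of x] by (simp add: ennreal_mult' indicator_def)
      qed simp
    qed
    finally show ?thesis using True by (simp add: mult.commute)
  qed simp
  have "ennreal (V / 2 * ?r powr (-s)) * (\<integral>\<^sup>+x. ennreal (w x) * indicator S x \<partial>lborel)
      = (\<integral>\<^sup>+x. ennreal (V / 2 * ?r powr (-s)) * (ennreal (w x) * indicator S x) \<partial>lborel)"
    by (rule nn_integral_cmult[symmetric]) measurable
  also have "\<dots> \<le> (\<integral>\<^sup>+x. \<integral>\<^sup>+y. ennreal (w x * of_bool (u y \<le> k - \<sigma> \<and> norm (x - y) \<le> \<sigma>) * frac_ker s (x - y)) \<partial>lborel \<partial>lborel)"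
    by (intro nn_integral_mono inner)
  also have "\<dots> = (\<integral>\<^sup>+p. ennreal (case p of (x, y) \<Rightarrow> w x * of_bool (u y \<le> k - \<sigma> \<and> norm (x - y) \<le> \<sigma>) * frac_ker s (x - y))
        \<partial>(lborel \<Otimes>\<^sub>M lborel))"
    by (subst lborel.nn_integral_fst[symmetric]) simp_all
  finally show ?thesis .
qed

lemma excess_integrable:
  assumes "0 < \<sigma>"
  shows "integrable lborel (excess u k \<rho> \<sigma>)"
proof (rule integrableI_bounded_set[where A = "ball 0 (\<rho> + \<sigma>)" and B = \<sigma>])
  show "emeasure lborel (ball (0::real^'n) (\<rho> + \<sigma>)) < \<infinity>" by (rule emeasure_bounded_finite) simp
  show "AE x in lborel. x \<in> ball 0 (\<rho> + \<sigma>) \<longrightarrow> norm (excess u k \<rho> \<sigma> x) \<le> \<sigma>"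
    using excess_le[OF assms, of u k \<rho>] by simp
  show "AE x in lborel. x \<notin> ball 0 (\<rho> + \<sigma>) \<longrightarrow> excess u k \<rho> \<sigma> x = 0"
  proof (rule AE_I2, rule impI)
    fix x :: "real^'n" assume "x \<notin> ball 0 (\<rho> + \<sigma>)"
    then show "excess u k \<rho> \<sigma> x = 0" by (intro excess_outside[OF assms]) simp
  qed
qed auto

lemma superlevel_fmeasurable: "{x \<in> ball 0 \<rho>. k < u x} \<in> fmeasurable lborel"
proof (rule fmeasurableI)
  show "{x \<in> ball 0 \<rho>. k < u x} \<in> sets lborel" by measurable
  show "emeasure lborel {x \<in> ball 0 \<rho>. k < u x} < \<infinity>"
    by (rule emeasure_bounded_finite) (rule bounded_subset[OF bounded_ball[of 0 \<rho>]], auto)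
qed

lemma measure_superlevel_mono:
  "\<rho> \<le> \<rho>' \<Longrightarrow> k' \<le> k \<Longrightarrow>
    measure lborel {x \<in> ball 0 \<rho>. k < u x} \<le> measure lborel {x \<in> ball 0 \<rho>'. k' < u x}"
  by (rule measure_mono_fmeasurable[OF _ fmeasurableD[OF superlevel_fmeasurable] superlevel_fmeasurable])
     auto

lemma ball_subset_enlarged:
  assumes "0 < \<sigma>" "norm x + \<sigma> \<le> r"
  shows "ball x (\<epsilon> * \<sigma>) \<subseteq> ball (0 :: real^'n) r"
proof
  fix y assume "y \<in> ball x (\<epsilon> * \<sigma>)"
  moreover have "\<epsilon> * \<sigma> \<le> \<sigma>" using eps assms(1) by simp
  ultimately have "norm (y - x) < \<sigma>" by (simp add: dist_norm norm_minus_commute)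
  then show "y \<in> ball 0 r" using assms(2) norm_triangle_ineq[of "y - x" x] by simp
qed

text \<open>The cut equals $\sigma$ on $\{u > k + \sigma\} \cap B_\rho$ and lives in $\{u > k\} \cap B_{\rho + \sigma}$.  So
  the gain bounds the measure of the first set from above by the cost, a multiple of the measure
  of the second, and the smallness of $\epsilon$ turns the ratio of constants into $2^{-n}$.\<close>
lemma superlevel_decay:
  assumes k: "M \<le> k" and \<rho>: "0 < \<rho>" and \<sigma>: "0 < \<sigma>" and R: "\<rho> + 2 * \<sigma> \<le> 2 * R"
    and few: "measure lborel {x \<in> ball 0 (\<rho> + \<sigma>). k - \<sigma> < u x} \<le> V / 2 * (\<epsilon> * \<sigma>) ^ CARD('n)"
  shows "2 ^ CARD('n) * measure lborel {x \<in> ball 0 \<rho>. k + \<sigma> < u x}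
    \<le> measure lborel {x \<in> ball 0 (\<rho> + \<sigma>). k < u x}"
proof -
  define w where "w = excess u k \<rho> \<sigma>"
  define S where "S = {x \<in> ball 0 \<rho>. k + \<sigma> < u x}"
  define T where "T = {x \<in> ball 0 (\<rho> + \<sigma>). k < u x}"
  define e where "e = (\<lambda>x. of_bool (0 < w x) :: real)"
  have w0: "0 \<le> w x" for x by (simp add: w_def)
  have [measurable]: "w \<in> borel_measurable borel" unfolding w_def by measurable
  have [measurable]: "S \<in> sets borel" "T \<in> sets borel"
    using fmeasurableD[OF superlevel_fmeasurable] by (simp_all add: S_def T_def)
  have e_le: "e x \<le> indicator T x" for x
    using excess_posD[OF \<sigma>, of u k \<rho> x] by (auto simp: e_def w_def T_def indicator_def)
  have T_int: "integrable lborel (indicator T :: _ \<Rightarrow> real)"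
    using superlevel_fmeasurable[of "\<rho> + \<sigma>" k] by (simp add: T_def fmeasurable_def)
  have e_int: "integrable lborel e"
  proof (rule Bochner_Integration.integrable_bound[OF T_int])
    show "e \<in> borel_measurable lborel" unfolding e_def by measurable
    show "AE x in lborel. norm (e x) \<le> norm (indicator T x :: real)"
      using e_le by (auto simp: e_def)
  qed
  have "(\<integral>x. e x \<partial>lborel) \<le> (\<integral>x. indicator T x \<partial>lborel)"
    by (rule integral_mono[OF e_int T_int]) (rule e_le)
  then have e_T: "(\<integral>x. e x \<partial>lborel) \<le> measure lborel T" by simp
  let ?gap = "\<lambda>(x, y). energy_gap s u (\<lambda>x. u x - w x) x y"
  let ?cost = "\<lambda>(x, y). (e x + e y) * (near \<sigma> (x - y) * frac_ker s (x - y))"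
  let ?gain = "\<lambda>(x, y). w x * of_bool (u y \<le> k - \<sigma> \<and> norm (x - y) \<le> \<sigma>) * frac_ker s (x - y)"
  have gap_int: "integrable (lborel \<Otimes>\<^sub>M lborel) ?gap" and gap_le: "integral\<^sup>L (lborel \<Otimes>\<^sub>M lborel) ?gap \<le> 0"
    using gap_integrable[OF k \<rho> \<sigma> R] gap_nonpos[OF k \<rho> \<sigma> R] by (simp_all add: w_def)
  have e0: "0 \<le> e x" for x by (simp add: e_def)
  note cost = weight_integral[OF e_int e0 \<sigma> J kernel_bound[OF \<sigma>]]
  have pw: "c * ?gain p \<le> ?gap p + 4 * \<sigma> * ?cost p" for p
  proof -
    obtain x y where p: "p = (x, y)" by (cases p)
    show ?thesis
      using energy_gap_gain[OF s \<sigma>, of u k \<rho> x y]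
      unfolding w_def[symmetric] c[symmetric] by (simp add: p e_def mult.assoc)
  qed
  have gain0: "0 \<le> ?gain p" for p using w0 by (auto split: prod.split)
  have "(\<integral>p. ?gap p + 4 * \<sigma> * ?cost p \<partial>(lborel \<Otimes>\<^sub>M lborel))
      = integral\<^sup>L (lborel \<Otimes>\<^sub>M lborel) ?gap + 4 * \<sigma> * integral\<^sup>L (lborel \<Otimes>\<^sub>M lborel) ?cost"
    using gap_int cost(1) by (subst Bochner_Integration.integral_add) auto
  also have "\<dots> \<le> 0 + 4 * \<sigma> * (2 * J * \<sigma> powr (-s) * measure lborel T)"
  proof (intro add_mono gap_le mult_left_mono)
    have "2 * J * \<sigma> powr (-s) * (\<integral>x. e x \<partial>lborel) \<le> 2 * J * \<sigma> powr (-s) * measure lborel T"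
      using e_T J by (intro mult_left_mono) auto
    with cost(2) show "integral\<^sup>L (lborel \<Otimes>\<^sub>M lborel) ?cost \<le> 2 * J * \<sigma> powr (-s) * measure lborel T"
      by (rule order_trans)
  qed (use \<sigma> in auto)
  finally have upper: "(\<integral>p. ?gap p + 4 * \<sigma> * ?cost p \<partial>(lborel \<Otimes>\<^sub>M lborel))
      \<le> 8 * \<sigma> * J * \<sigma> powr (-s) * measure lborel T" by (simp add: mult.assoc)
  have "ennreal c * (\<integral>\<^sup>+p. ennreal (?gain p) \<partial>(lborel \<Otimes>\<^sub>M lborel))
      = (\<integral>\<^sup>+p. ennreal c * ennreal (?gain p) \<partial>(lborel \<Otimes>\<^sub>M lborel))"
    by (rule nn_integral_cmult[symmetric]) measurable
  also have "\<dots> \<le> (\<integral>\<^sup>+p. ennreal (?gap p + 4 * \<sigma> * ?cost p) \<partial>(lborel \<Otimes>\<^sub>M lborel))"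
    using pw c_pos by (intro nn_integral_mono) (simp add: ennreal_mult'[symmetric] ennreal_leI)
  also have "\<dots> = ennreal (\<integral>p. ?gap p + 4 * \<sigma> * ?cost p \<partial>(lborel \<Otimes>\<^sub>M lborel))"
  proof (rule nn_integral_eq_integral)
    show "integrable (lborel \<Otimes>\<^sub>M lborel) (\<lambda>p. ?gap p + 4 * \<sigma> * ?cost p)"
      using gap_int cost(1) by (intro Bochner_Integration.integrable_add integrable_mult_right)
    have "0 \<le> ?gap p + 4 * \<sigma> * ?cost p" for p
      using pw[of p] gain0[of p] c_pos by (smt (verit) mult_nonneg_nonneg)
    then show "AE p in lborel \<Otimes>\<^sub>M lborel. 0 \<le> ?gap p + 4 * \<sigma> * ?cost p" by simp
  qed
  also have "\<dots> \<le> ennreal (8 * \<sigma> * J * \<sigma> powr (-s) * measure lborel T)"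
    by (rule ennreal_leI[OF upper])
  finally have gain_le: "ennreal c * (\<integral>\<^sup>+p. ennreal (?gain p) \<partial>(lborel \<Otimes>\<^sub>M lborel))
      \<le> ennreal (8 * \<sigma> * J * \<sigma> powr (-s) * measure lborel T)" .
  have sub: "ball x (\<epsilon> * \<sigma>) \<subseteq> ball 0 (\<rho> + \<sigma>)" if "x \<in> S" for x
    using ball_subset_enlarged[OF \<sigma>, of x "\<rho> + \<sigma>"] that by (simp add: S_def)
  have wS: "ennreal (w x) * indicator S x = ennreal \<sigma> * indicator S x" for x
    using excess_inside[OF \<sigma>, of x \<rho> k u] by (auto simp: w_def S_def indicator_def)
  have "(\<integral>\<^sup>+x. ennreal (w x) * indicator S x \<partial>lborel) = ennreal \<sigma> * emeasure lborel S"
    unfolding wS by (rule nn_integral_cmult_indicator) simp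
  also have "emeasure lborel S = ennreal (measure lborel S)"
    using superlevel_fmeasurable[of \<rho> "k + \<sigma>"] by (simp add: S_def emeasure_eq_measure2)
  finally have wS_int: "(\<integral>\<^sup>+x. ennreal (w x) * indicator S x \<partial>lborel) = ennreal (\<sigma> * measure lborel S)"
    using \<sigma> by (simp add: ennreal_mult')
  have "ennreal (c * (V / 2 * (\<epsilon> * \<sigma>) powr (-s) * (\<sigma> * measure lborel S)))
      = ennreal c * (ennreal (V / 2 * (\<epsilon> * \<sigma>) powr (-s)) * (\<integral>\<^sup>+x. ennreal (w x) * indicator S x \<partial>lborel))"
  proof -
    have "0 \<le> V / 2 * (\<epsilon> * \<sigma>) powr (-s)" using V_pos by simp
    then show ?thesis
      unfolding wS_int by (simp only: ennreal_mult'[OF less_imp_le[OF c_pos]] ennreal_mult')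
  qed
  also have "\<dots> \<le> ennreal c * (\<integral>\<^sup>+p. ennreal (?gain p) \<partial>(lborel \<Otimes>\<^sub>M lborel))"
    by (intro mult_left_mono gain_integral_lower_bound[where B = "ball 0 (\<rho> + \<sigma>)"] w0 \<sigma> sub few) auto
  also note gain_le
  finally have "c * (V / 2 * (\<epsilon> * \<sigma>) powr (-s) * (\<sigma> * measure lborel S)) \<le> 8 * \<sigma> * J * \<sigma> powr (-s) * measure lborel T"
    using J \<sigma> by (subst (asm) ennreal_le_iff) auto
  then have "(\<sigma> * \<sigma> powr (-s)) * (c * V * \<epsilon> powr (-s) * measure lborel S)
      \<le> (\<sigma> * \<sigma> powr (-s)) * (16 * J * measure lborel T)"
    using eps \<sigma> by (simp add: powr_mult algebra_simps)
  then have *: "c * V * \<epsilon> powr (-s) * measure lborel S \<le> 16 * J * measure lborel T"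
    using \<sigma> by (subst (asm) mult_le_cancel_left_pos) auto
  have "16 * J * (2 ^ CARD('n) * measure lborel S) = (16 * J * \<epsilon> powr s * 2 ^ CARD('n)) * (\<epsilon> powr (-s) * measure lborel S)"
    using eps by (simp add: powr_minus)
  also have "\<dots> \<le> c * V * (\<epsilon> powr (-s) * measure lborel S)"
    by (intro mult_right_mono eps_small) auto
  also have "\<dots> \<le> 16 * J * measure lborel T" using * by (simp add: mult.assoc)
  finally show ?thesis using J unfolding S_def T_def by (subst (asm) mult_le_cancel_left_pos) auto
qed

text \<open>The decay factor $2^{-n}$ is exactly what preserves the density hypothesis when $\sigma$ is halved, so
  \<open>superlevel_decay\<close> can be repeated for ever.  The levels rise by $2\sigma_j$ and the radii shrink by
  $\sigma_j$, with finite total change, and the superlevel set at the limit is null.\<close>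
lemma bounded_by_level:
  assumes k0: "M \<le> k0" and \<sigma>0: "0 < \<sigma>0" and \<rho>0: "2 * \<sigma>0 < \<rho>0" and R: "\<rho>0 + \<sigma>0 \<le> 2 * R"
    and few: "measure lborel {x \<in> ball 0 \<rho>0. k0 < u x} \<le> V / 2 * (\<epsilon> * \<sigma>0) ^ CARD('n)"
  shows "AE x in lborel. norm x < \<rho>0 - 2 * \<sigma>0 \<longrightarrow> u x \<le> k0 + 4 * \<sigma>0"
proof -
  define \<sigma> where "\<sigma> j = \<sigma>0 * (1/2) ^ j" for j :: nat
  define \<rho> where "\<rho> j = \<rho>0 - 2 * \<sigma>0 + 2 * \<sigma> j" for j
  define k where "k j = k0 + 4 * \<sigma>0 - 4 * \<sigma> j" for j
  define X where "X j = measure lborel {x \<in> ball 0 (\<rho> j). k j < u x}" for j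
  have \<sigma>_pos: "0 < \<sigma> j" for j using \<sigma>0 by (simp add: \<sigma>_def)
  have \<sigma>_le: "\<sigma> j \<le> \<sigma>0" for j using \<sigma>0 by (simp add: \<sigma>_def mult_le_cancel_left1 power_le_one)
  have \<sigma>_Suc: "\<sigma> (Suc j) = \<sigma> j / 2" for j by (simp add: \<sigma>_def)
  have X: "X j \<le> V / 2 * (\<epsilon> * \<sigma> j) ^ CARD('n)" for j
  proof (induction j)
    case 0
    then show ?case using few by (simp add: X_def \<rho>_def k_def \<sigma>_def)
  next
    case (Suc j)
    have eqs: "\<rho> (Suc j) + \<sigma> j = \<rho> j" "k j + \<sigma> j - \<sigma> j = k j" "k j + \<sigma> j + \<sigma> j = k (Suc j)"
      by (simp_all add: \<rho>_def k_def \<sigma>_Suc)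
    have "M \<le> k j + \<sigma> j" using k0 \<sigma>_le[of j] \<sigma>_pos[of j] by (simp add: k_def)
    moreover have "0 < \<rho> (Suc j)" using \<rho>0 \<sigma>_pos[of "Suc j"] by (simp add: \<rho>_def)
    moreover have "\<rho> (Suc j) + 2 * \<sigma> j \<le> 2 * R" using R \<sigma>_le[of j] by (simp add: \<rho>_def \<sigma>_Suc)
    ultimately have "2 ^ CARD('n) * measure lborel {x \<in> ball 0 (\<rho> (Suc j)). k j + \<sigma> j + \<sigma> j < u x}
        \<le> measure lborel {x \<in> ball 0 (\<rho> (Suc j) + \<sigma> j). k j + \<sigma> j < u x}"
      using Suc.IH \<sigma>_pos[of j] by (intro superlevel_decay) (simp_all only: eqs X_def)
    also have "\<dots> \<le> X j"
      unfolding X_def eqs using \<sigma>_pos[of j] by (intro measure_superlevel_mono) auto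
    also note Suc.IH
    finally have "2 ^ CARD('n) * X (Suc j) \<le> V / 2 * (\<epsilon> * \<sigma> j) ^ CARD('n)"
      unfolding eqs X_def .
    also have "\<dots> = 2 ^ CARD('n) * (V / 2 * (\<epsilon> * \<sigma> (Suc j)) ^ CARD('n))"
      by (simp add: \<sigma>_Suc power_mult_distrib power_divide)
    finally show ?case by simp
  qed
  define Z where "Z = {x \<in> ball 0 (\<rho>0 - 2 * \<sigma>0). k0 + 4 * \<sigma>0 < u x}"
  have "measure lborel Z \<le> V / 2 * (\<epsilon> * \<sigma> j) ^ CARD('n)" for j
  proof -
    have "measure lborel Z \<le> X j"
      unfolding Z_def X_def using \<sigma>_pos[of j] by (intro measure_superlevel_mono) (auto simp: \<rho>_def k_def)
    with X[of j] show ?thesis by linarith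
  qed
  moreover have "(\<lambda>j. V / 2 * (\<epsilon> * \<sigma> j) ^ CARD('n)) \<longlonglongrightarrow> V / 2 * (\<epsilon> * (\<sigma>0 * 0)) ^ CARD('n)"
    unfolding \<sigma>_def by (intro tendsto_intros LIMSEQ_realpow_zero) auto
  ultimately have "measure lborel Z \<le> V / 2 * (\<epsilon> * (\<sigma>0 * 0)) ^ CARD('n)"
    by (intro LIMSEQ_le_const) auto
  then have "measure lborel Z = 0" using measure_nonneg[of lborel Z] by (simp add: power_0_left)
  then have "emeasure lborel Z = 0"
    using superlevel_fmeasurable[of "\<rho>0 - 2 * \<sigma>0" "k0 + 4 * \<sigma>0"] by (simp add: Z_def emeasure_eq_measure2)
  then have "AE x in lborel. x \<notin> Z"
    using fmeasurableD[OF superlevel_fmeasurable[of "\<rho>0 - 2 * \<sigma>0" "k0 + 4 * \<sigma>0"]]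
    by (intro AE_not_in) (auto simp: Z_def null_sets_def)
  then show ?thesis by eventually_elim (auto simp: Z_def)
qed

text \<open>For a fixed displacement $z$ everything is integrable in $x$, so the term with $w(x + z)$ can be
  shifted by $-z$.  By antisymmetry it becomes $w(x)$ times the slope in the direction $-z$, and
  \<open>barrier_slope_reflection\<close> applies.  Integrating in $x$ before $z$ thus produces the principal
  value without any limit.\<close>
lemma barrier_flux_bound:
  fixes w :: "real^'n \<Rightarrow> real"
  assumes \<rho>: "0 < \<rho>" and \<sigma>: "0 < \<sigma>" and w: "integrable lborel w" "\<And>x. 0 \<le> w x"
    and wdiff: "integrable (lborel \<Otimes>\<^sub>M lborel) (\<lambda>(x, y). (w x - w y) * frac_ker s (x - y))"
  shows "integrable (lborel \<Otimes>\<^sub>M lborel) (\<lambda>(x, y). barrier_slope s \<rho> \<sigma> x y * (w x - w y) * frac_ker s (x - y))"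
      (is "integrable _ ?\<Phi>")
    and "- (4 * J * \<sigma> powr (-s) * (\<integral>x. w x \<partial>lborel))
      \<le> (\<integral>(x, y). barrier_slope s \<rho> \<sigma> x y * (w x - w y) * frac_ker s (x - y) \<partial>(lborel \<Otimes>\<^sub>M lborel))"
proof -
  have [measurable]: "w \<in> borel_measurable borel" using borel_measurable_integrable[OF w(1)] by simp
  let ?F = "barrier_slope s \<rho> \<sigma> :: real^'n \<Rightarrow> real^'n \<Rightarrow> real"
  have F2: "\<bar>?F x y\<bar> \<le> 2" for x y by (rule abs_barrier_slope_le[OF s])
  define \<Phi> where "\<Phi> = ?\<Phi>"
  define \<Psi> where "\<Psi> = (\<lambda>(x, z). \<Phi> (x, x + z))"
  have \<Phi>_meas [measurable]: "\<Phi> \<in> borel_measurable (lborel \<Otimes>\<^sub>M lborel)" unfolding \<Phi>_def by measurable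
  have \<Phi>_meas' [measurable]: "\<Phi> \<in> borel_measurable (borel \<Otimes>\<^sub>M borel)" unfolding \<Phi>_def by measurable
  have \<Psi>_meas [measurable]: "\<Psi> \<in> borel_measurable (lborel \<Otimes>\<^sub>M lborel)" unfolding \<Psi>_def by measurable
  show \<Phi>_int: "integrable (lborel \<Otimes>\<^sub>M lborel) ?\<Phi>"
  proof (rule Bochner_Integration.integrable_bound[OF integrable_mult_right[OF wdiff, of 2]])
    show "?\<Phi> \<in> borel_measurable (lborel \<Otimes>\<^sub>M lborel)" by measurable
    have "norm (?\<Phi> p) \<le> norm (2 * (case p of (x, y) \<Rightarrow> (w x - w y) * frac_ker s (x - y)))" for p
    proof -
      obtain x y where p: "p = (x, y)" by (cases p)
      have "\<bar>?F x y\<bar> * (\<bar>w x - w y\<bar> * frac_ker s (x - y)) \<le> 2 * (\<bar>w x - w y\<bar> * frac_ker s (x - y))"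
        by (intro mult_right_mono F2) auto
      then show ?thesis by (simp add: p abs_mult)
    qed
    then show "AE p in lborel \<Otimes>\<^sub>M lborel. norm (?\<Phi> p) \<le> norm (2 * (case p of (x, y) \<Rightarrow> (w x - w y) * frac_ker s (x - y)))"
      by simp
  qed
  have \<Phi>_int': "integrable (lborel \<Otimes>\<^sub>M lborel) \<Phi>" using \<Phi>_int by (simp add: \<Phi>_def)
  have \<Psi>_int: "integrable (lborel \<Otimes>\<^sub>M lborel) \<Psi>"
  proof (rule integrableI_bounded)
    have "(\<integral>\<^sup>+p. ennreal (norm (\<Psi> p)) \<partial>(lborel \<Otimes>\<^sub>M lborel)) = (\<integral>\<^sup>+x. \<integral>\<^sup>+z. ennreal (norm (\<Phi> (x, x + z))) \<partial>lborel \<partial>lborel)"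
      by (subst lborel.nn_integral_fst[symmetric]) (simp_all add: \<Psi>_def)
    also have "\<dots> = (\<integral>\<^sup>+x. \<integral>\<^sup>+y. ennreal (norm (\<Phi> (x, y))) \<partial>lborel \<partial>lborel)"
      by (intro nn_integral_cong nn_integral_lborel_translate[where f = "\<lambda>y. ennreal (norm (\<Phi> (_, y)))"]) measurable
    also have "\<dots> = (\<integral>\<^sup>+p. ennreal (norm (\<Phi> p)) \<partial>(lborel \<Otimes>\<^sub>M lborel))"
      by (rule lborel.nn_integral_fst) measurable
    also have "\<dots> < \<infinity>" using \<Phi>_int' by (simp add: integrable_iff_bounded)
    finally show "(\<integral>\<^sup>+p. ennreal (norm (\<Psi> p)) \<partial>(lborel \<Otimes>\<^sub>M lborel)) < \<infinity>" .
  qed measurable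
  have "(\<integral>p. \<Phi> p \<partial>(lborel \<Otimes>\<^sub>M lborel)) = (\<integral>x. \<integral>y. \<Phi> (x, y) \<partial>lborel \<partial>lborel)"
    by (rule lborel_pair.integral_fst'[symmetric, OF \<Phi>_int'])
  also have "\<dots> = (\<integral>x. \<integral>z. \<Psi> (x, z) \<partial>lborel \<partial>lborel)"
    unfolding \<Psi>_def prod.case
    by (intro Bochner_Integration.integral_cong refl integral_lborel_translate[where f = "\<lambda>y. \<Phi> (_, y)", symmetric]) measurable
  also have "\<dots> = (\<integral>z. \<integral>x. \<Psi> (x, z) \<partial>lborel \<partial>lborel)"
    using lborel_pair.Fubini_integral[of "\<lambda>x z. \<Psi> (x, z)"] \<Psi>_int by simp
  finally have swap: "(\<integral>p. \<Phi> p \<partial>(lborel \<Otimes>\<^sub>M lborel)) = (\<integral>z. \<integral>x. \<Psi> (x, z) \<partial>lborel \<partial>lborel)" .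
  define I where "I = (\<integral>x. w x \<partial>lborel)"
  have I: "0 \<le> I" unfolding I_def using w(2) by simp
  have slice: "- (4 * I * (near \<sigma> z * frac_ker s z)) \<le> (\<integral>x. \<Psi> (x, z) \<partial>lborel)" for z
  proof -
    have int: "integrable lborel (\<lambda>x. h x * w x)" if [measurable]: "h \<in> borel_measurable borel" and h: "\<And>x. \<bar>h x\<bar> \<le> 2"
      for h :: "real^'n \<Rightarrow> real"
    proof (rule Bochner_Integration.integrable_bound[OF integrable_mult_right[OF w(1), of 2]])
      show "AE x in lborel. norm (h x * w x) \<le> norm (2 * w x)"
        using h w(2) by (auto simp: abs_mult intro: mult_right_mono)
    qed measurable
    have i1: "integrable lborel (\<lambda>x. ?F x (x + z) * w x)" and i2: "integrable lborel (\<lambda>x. ?F x (x - z) * w x)"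
      by (rule int, measurable, rule F2)+
    have [measurable]: "(\<lambda>x. ?F x (x - z) * w x) \<in> borel_measurable borel" by measurable
    have i3: "integrable lborel (\<lambda>x. ?F (z + x) (z + x - z) * w (z + x))"
      by (rule integrable_lborel_translate[OF i2])
    have e3: "(\<integral>x. ?F (z + x) (z + x - z) * w (z + x) \<partial>lborel) = (\<integral>x. ?F x (x - z) * w x \<partial>lborel)"
      by (rule integral_lborel_translate[of "\<lambda>x. ?F x (x - z) * w x"]) measurable
    have "\<Psi> (x, z) = frac_ker s z * (?F x (x + z) * w x + ?F (z + x) (z + x - z) * w (z + x))" for x
      using barrier_slope_antisym[of s \<rho> \<sigma> "z + x" x] frac_ker_minus(1)[of s z]
      by (simp add: \<Psi>_def \<Phi>_def algebra_simps)
    then have "(\<integral>x. \<Psi> (x, z) \<partial>lborel)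
        = frac_ker s z * ((\<integral>x. ?F x (x + z) * w x \<partial>lborel) + (\<integral>x. ?F x (x - z) * w x \<partial>lborel))"
      using i1 i3 e3 by (simp add: Bochner_Integration.integral_add)
    also have "(\<integral>x. ?F x (x + z) * w x \<partial>lborel) + (\<integral>x. ?F x (x - z) * w x \<partial>lborel)
        = (\<integral>x. (?F x (x + z) + ?F x (x - z)) * w x \<partial>lborel)"
      using i1 i2 by (simp add: distrib_right Bochner_Integration.integral_add)
    finally have eq: "(\<integral>x. \<Psi> (x, z) \<partial>lborel) = frac_ker s z * (\<integral>x. (?F x (x + z) + ?F x (x - z)) * w x \<partial>lborel)" .
    have "- (4 * near \<sigma> z) * I = (\<integral>x. - (4 * near \<sigma> z) * w x \<partial>lborel)"
      by (simp add: I_def)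
    also have "\<dots> \<le> (\<integral>x. (?F x (x + z) + ?F x (x - z)) * w x \<partial>lborel)"
    proof (rule integral_mono)
      show "integrable lborel (\<lambda>x. (?F x (x + z) + ?F x (x - z)) * w x)"
        using i1 i2 by (simp add: distrib_right)
      show "- (4 * near \<sigma> z) * w x \<le> (?F x (x + z) + ?F x (x - z)) * w x" for x
        by (intro mult_right_mono barrier_slope_reflection s \<sigma> \<rho> w(2))
    qed (use w(1) in auto)
    finally have "frac_ker s z * (- (4 * near \<sigma> z) * I) \<le> (\<integral>x. \<Psi> (x, z) \<partial>lborel)"
      unfolding eq by (intro mult_left_mono) auto
    then show ?thesis by (simp add: algebra_simps)
  qed
  let ?k = "\<lambda>z :: real^'n. near \<sigma> z * frac_ker s z"
  have k0: "0 \<le> ?k z" for z using \<sigma> by (rule near_frac_ker_nonneg)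
  have k_int: "integrable lborel ?k"
  proof (rule integrableI_nonneg)
    show "(\<integral>\<^sup>+z. ennreal (?k z) \<partial>lborel) < \<infinity>"
      using kernel_bound[OF \<sigma>] by (rule le_less_trans) simp
  qed (use k0 in auto)
  have "ennreal (\<integral>z. ?k z \<partial>lborel) \<le> ennreal (J * \<sigma> powr (-s))"
    using kernel_bound[OF \<sigma>] by (subst (asm) nn_integral_eq_integral[OF k_int]) (use k0 in auto)
  then have k_le: "(\<integral>z. ?k z \<partial>lborel) \<le> J * \<sigma> powr (-s)"
    using J by (subst (asm) ennreal_le_iff) auto
  have "4 * I * (\<integral>z. ?k z \<partial>lborel) \<le> 4 * I * (J * \<sigma> powr (-s))"
    using k_le I by (intro mult_left_mono) auto
  moreover have "- (4 * I * (\<integral>z. ?k z \<partial>lborel)) \<le> (\<integral>z. \<integral>x. \<Psi> (x, z) \<partial>lborel \<partial>lborel)"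
  proof -
    have "- (4 * I * (\<integral>z. ?k z \<partial>lborel)) = (\<integral>z. - (4 * I * ?k z) \<partial>lborel)" by simp
    also have "\<dots> \<le> (\<integral>z. \<integral>x. \<Psi> (x, z) \<partial>lborel \<partial>lborel)"
    proof (rule integral_mono)
      show "integrable lborel (\<lambda>z. \<integral>x. \<Psi> (x, z) \<partial>lborel)"
        using lborel_pair.integrable_snd[of "\<lambda>x z. \<Psi> (x, z)"] \<Psi>_int by simp
    qed (use k_int slice in auto)
    finally show ?thesis .
  qed
  ultimately show "- (4 * J * \<sigma> powr (-s) * (\<integral>x. w x \<partial>lborel)) \<le> integral\<^sup>L (lborel \<Otimes>\<^sub>M lborel) ?\<Phi>"
    unfolding swap[unfolded \<Phi>_def] I_def[symmetric] by (simp add: algebra_simps)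
qed

text \<open>The gain is linear in the cut with a large constant, the cost linear with a bounded one; both are
  multiplied by $\sigma^{-s} \int w$, so this integral vanishes.\<close>
lemma barrier_comparison:
  assumes k: "M \<le> k" and \<rho>: "0 < \<rho>" and \<sigma>: "0 < \<sigma>" and R: "\<rho> + 2 * \<sigma> \<le> 2 * R"
    and bd: "AE x in lborel. norm x < \<rho> + 2 * \<sigma> \<longrightarrow> u x \<le> k + \<sigma>"
    and few: "measure lborel {x \<in> ball 0 (\<rho> + 2 * \<sigma>). k - \<sigma> < u x} \<le> V / 2 * (\<epsilon> * \<sigma>) ^ CARD('n)"
  shows "AE x in lborel. norm x < \<rho> \<longrightarrow> u x \<le> k"
proof -
  define w where "w = excess u k \<rho> \<sigma>"
  have w0: "0 \<le> w x" for x by (simp add: w_def)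
  have [measurable]: "w \<in> borel_measurable borel" unfolding w_def by measurable
  have w_int: "integrable lborel w" unfolding w_def by (rule excess_integrable[OF \<sigma>])
  define I where "I = (\<integral>x. w x \<partial>lborel)"
  have I: "0 \<le> I" unfolding I_def using w0 by simp
  let ?gap = "\<lambda>(x, y). energy_gap s u (\<lambda>x. u x - w x) x y"
  let ?flux = "\<lambda>(x, y). barrier_slope s \<rho> \<sigma> x y * (w x - w y) * frac_ker s (x - y)"
  let ?cost = "\<lambda>(x, y). (w x + w y) * (near \<sigma> (x - y) * frac_ker s (x - y))"
  let ?gain = "\<lambda>(x, y). w x * of_bool (u y \<le> k - \<sigma> \<and> norm (x - y) \<le> \<sigma>) * frac_ker s (x - y)"
  have gap_int: "integrable (lborel \<Otimes>\<^sub>M lborel) ?gap" and gap_le: "integral\<^sup>L (lborel \<Otimes>\<^sub>M lborel) ?gap \<le> 0"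
    using gap_integrable[OF k \<rho> \<sigma> R] gap_nonpos[OF k \<rho> \<sigma> R] by (simp_all add: w_def)
  have wdiff: "integrable (lborel \<Otimes>\<^sub>M lborel) (\<lambda>(x, y). (w x - w y) * frac_ker s (x - y))"
    using excess_diff_integrable[OF k \<rho> \<sigma> R] by (simp add: w_def)
  note flux = barrier_flux_bound[OF \<rho> \<sigma> w_int w0 wdiff]
  note cost = weight_integral[OF w_int w0 \<sigma> J kernel_bound[OF \<sigma>]]
  have gain0: "0 \<le> ?gain p" for p using w0 by (auto split: prod.split)
  have pw: "AE p in lborel \<Otimes>\<^sub>M lborel. c * ?gain p \<le> ?gap p - ?flux p + 4 * ?cost p"
  proof -
    let ?P = "\<lambda>x. norm x < \<rho> + 2 * \<sigma> \<longrightarrow> u x \<le> k + \<sigma>"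
    have "AE p in lborel \<Otimes>\<^sub>M lborel. ?P (fst p) \<and> ?P (snd p)"
    proof (rule lborel_pair.AE_pair_measure)
      show "{p \<in> space (lborel \<Otimes>\<^sub>M lborel). ?P (fst p) \<and> ?P (snd p)} \<in> sets (lborel \<Otimes>\<^sub>M lborel)"
        by measurable
      show "AE x in lborel. AE y in lborel. ?P (fst (x, y)) \<and> ?P (snd (x, y))"
        using bd by eventually_elim (use bd in simp)
    qed
    then show ?thesis
    proof eventually_elim
      case (elim p)
      obtain x y where p: "p = (x, y)" by (cases p)
      show ?case
        using energy_gap_gain_bounded[OF s \<sigma>, of x \<rho> u k y] elim
        unfolding w_def[symmetric] c[symmetric] by (simp only: p prod.case mult.assoc fst_conv snd_conv)
    qed
  qed
  have rhs_int: "integrable (lborel \<Otimes>\<^sub>M lborel) (\<lambda>p. ?gap p - ?flux p + 4 * ?cost p)"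
    using gap_int flux(1) cost(1)
    by (intro Bochner_Integration.integrable_add Bochner_Integration.integrable_diff integrable_mult_right)
  have "(\<integral>p. ?gap p - ?flux p + 4 * ?cost p \<partial>(lborel \<Otimes>\<^sub>M lborel))
      = integral\<^sup>L (lborel \<Otimes>\<^sub>M lborel) ?gap - integral\<^sup>L (lborel \<Otimes>\<^sub>M lborel) ?flux
        + 4 * integral\<^sup>L (lborel \<Otimes>\<^sub>M lborel) ?cost"
  proof -
    have "(\<integral>p. a p - b p + 4 * d p \<partial>N) = integral\<^sup>L N a - integral\<^sup>L N b + 4 * integral\<^sup>L N d"
      if "integrable N a" "integrable N b" "integrable N d"
      for a b d :: "(real^'n) \<times> (real^'n) \<Rightarrow> real" and N using that by simp
    from this[OF gap_int flux(1) cost(1)] show ?thesis .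
  qed
  also have "\<dots> \<le> 12 * J * \<sigma> powr (-s) * I"
    using gap_le flux(2) cost(2) unfolding I_def by linarith
  finally have upper: "(\<integral>p. ?gap p - ?flux p + 4 * ?cost p \<partial>(lborel \<Otimes>\<^sub>M lborel)) \<le> 12 * J * \<sigma> powr (-s) * I" .
  have "ennreal c * (\<integral>\<^sup>+p. ennreal (?gain p) \<partial>(lborel \<Otimes>\<^sub>M lborel))
      = (\<integral>\<^sup>+p. ennreal c * ennreal (?gain p) \<partial>(lborel \<Otimes>\<^sub>M lborel))"
    by (rule nn_integral_cmult[symmetric]) measurable
  also have "\<dots> \<le> (\<integral>\<^sup>+p. ennreal (?gap p - ?flux p + 4 * ?cost p) \<partial>(lborel \<Otimes>\<^sub>M lborel))"
  proof (rule nn_integral_mono_AE)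
    show "AE p in lborel \<Otimes>\<^sub>M lborel. ennreal c * ennreal (?gain p) \<le> ennreal (?gap p - ?flux p + 4 * ?cost p)"
      using pw by eventually_elim (use c_pos in \<open>simp only: ennreal_mult'[symmetric] less_imp_le ennreal_leI\<close>)
  qed
  also have "\<dots> = ennreal (\<integral>p. ?gap p - ?flux p + 4 * ?cost p \<partial>(lborel \<Otimes>\<^sub>M lborel))"
  proof (rule nn_integral_eq_integral[OF rhs_int])
    show "AE p in lborel \<Otimes>\<^sub>M lborel. 0 \<le> ?gap p - ?flux p + 4 * ?cost p"
      using pw
    proof eventually_elim
      case (elim p)
      have "0 \<le> c * ?gain p" using gain0[of p] c_pos by (intro mult_nonneg_nonneg) auto
      with elim show ?case by linarith
    qed
  qed
  also have "\<dots> \<le> ennreal (12 * J * \<sigma> powr (-s) * I)" by (rule ennreal_leI[OF upper])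
  finally have gain_le: "ennreal c * (\<integral>\<^sup>+p. ennreal (?gain p) \<partial>(lborel \<Otimes>\<^sub>M lborel)) \<le> ennreal (12 * J * \<sigma> powr (-s) * I)" .
  define S where "S = ball (0::real^'n) (\<rho> + \<sigma>)"
  have sub: "ball x (\<epsilon> * \<sigma>) \<subseteq> ball 0 (\<rho> + 2 * \<sigma>)" if "x \<in> S" for x
    using ball_subset_enlarged[OF \<sigma>, of x "\<rho> + 2 * \<sigma>"] that by (simp add: S_def)
  have wS: "ennreal (w x) * indicator S x = ennreal (w x)" for x
    using excess_outside[OF \<sigma>, of \<rho> x u k] by (auto simp: w_def S_def indicator_def not_less)
  have wS_int: "(\<integral>\<^sup>+x. ennreal (w x) * indicator S x \<partial>lborel) = ennreal I"
    unfolding wS I_def using w0 by (intro nn_integral_eq_integral w_int) auto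
  have "ennreal (c * (V / 2 * (\<epsilon> * \<sigma>) powr (-s) * I))
      = ennreal c * (ennreal (V / 2 * (\<epsilon> * \<sigma>) powr (-s)) * (\<integral>\<^sup>+x. ennreal (w x) * indicator S x \<partial>lborel))"
  proof -
    have "0 \<le> V / 2 * (\<epsilon> * \<sigma>) powr (-s)" using V_pos by simp
    then show ?thesis
      unfolding wS_int by (simp only: ennreal_mult'[OF less_imp_le[OF c_pos]] ennreal_mult')
  qed
  also have "\<dots> \<le> ennreal c * (\<integral>\<^sup>+p. ennreal (?gain p) \<partial>(lborel \<Otimes>\<^sub>M lborel))"
    by (intro mult_left_mono gain_integral_lower_bound[where B = "ball 0 (\<rho> + 2 * \<sigma>)"] w0 \<sigma> sub few)
       (auto simp: S_def)
  also note gain_le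
  finally have "c * (V / 2 * (\<epsilon> * \<sigma>) powr (-s) * I) \<le> 12 * J * \<sigma> powr (-s) * I"
    using J I by (subst (asm) ennreal_le_iff) auto
  then have "\<sigma> powr (-s) * (c * V * \<epsilon> powr (-s) * I) \<le> \<sigma> powr (-s) * (24 * J * I)"
    using eps \<sigma> by (simp add: powr_mult algebra_simps)
  then have *: "c * V * \<epsilon> powr (-s) * I \<le> 24 * J * I"
    using \<sigma> by (subst (asm) mult_le_cancel_left_pos) auto
  have "32 * J * I \<le> 16 * J * I * 2 ^ CARD('n)"
  proof -
    have "(2::real) ^ 1 \<le> 2 ^ CARD('n)" by (intro power_increasing) (auto simp: Suc_leI)
    then have "16 * J * I * 2 \<le> 16 * J * I * 2 ^ CARD('n)" using J I by (intro mult_left_mono) auto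
    then show ?thesis by simp
  qed
  also have "\<dots> = (16 * J * \<epsilon> powr s * 2 ^ CARD('n)) * (\<epsilon> powr (-s) * I)"
    using eps by (simp add: powr_minus)
  also have "\<dots> \<le> c * V * (\<epsilon> powr (-s) * I)"
    using I by (intro mult_right_mono eps_small) auto
  also have "\<dots> \<le> 24 * J * I" using * by (simp add: mult.assoc)
  finally have "J * I \<le> 0" by (simp add: mult.commute)
  then have "I = 0" using J I by (simp add: mult_le_0_iff)
  then have "AE x in lborel. w x = 0"
    using integral_nonneg_eq_0_iff_AE[OF w_int] w0 by (simp add: I_def)
  then show ?thesis
  proof eventually_elim
    case (elim x)
    show ?case
    proof
      assume "norm x < \<rho>"
      then have "max 0 (min (u x) (k + \<sigma>) - k) = 0" using elim by (simp add: w_def excess_def barrier_inside)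
      then show "u x \<le> k" using \<sigma> by linarith
    qed
  qed
qed

end

section \<open>Solutions of the obstacle problem\<close>

lemma AE_product_both:
  fixes P :: "real^'n \<Rightarrow> bool"
  assumes "AE x in lborel. P x"
  shows "AE p in (lborel :: (real^'n) measure) \<Otimes>\<^sub>M lborel. P (fst p) \<and> P (snd p)"
proof -
  obtain N where N: "N \<in> null_sets (lborel :: (real^'n) measure)" "{x \<in> space lborel. \<not> P x} \<subseteq> N"
    using assms unfolding eventually_ae_filter by auto
  have [measurable]: "N \<in> sets borel" using N(1) by (auto simp: null_sets_def)
  have ae: "AE x in lborel. x \<notin> N" using N(1) by (rule AE_not_in)
  have "AE p in (lborel :: (real^'n) measure) \<Otimes>\<^sub>M lborel. fst p \<notin> N \<and> snd p \<notin> N"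
  proof (rule lborel_pair.AE_pair_measure)
    show "{p \<in> space (lborel \<Otimes>\<^sub>M lborel). fst p \<notin> N \<and> snd p \<notin> N} \<in> sets (lborel \<Otimes>\<^sub>M lborel)" by measurable
    show "AE x in lborel. AE y in lborel. fst (x, y) \<notin> N \<and> snd (x, y) \<notin> N"
      using ae by eventually_elim (use ae in simp)
  qed
  then show ?thesis by eventually_elim (use N(2) in auto)
qed

definition seminorm_density :: "real \<Rightarrow> (real^'n) set \<Rightarrow> (real^'n \<Rightarrow> real) \<Rightarrow> (real^'n) \<times> (real^'n) \<Rightarrow> real" where
  "seminorm_density s \<Omega> u p = (case p of (x, y) \<Rightarrow> indicator \<Omega> x * indicator \<Omega> y * \<bar>u x - u y\<bar> * frac_ker s (x - y))"

lemma seminorm_density_nonneg: "0 \<le> seminorm_density s \<Omega> u p"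
  by (auto simp: seminorm_density_def split: prod.split)

lemma borel_measurable_seminorm_density:
  assumes [measurable]: "u \<in> borel_measurable borel" "\<Omega> \<in> sets borel"
  shows "seminorm_density s \<Omega> u \<in> borel_measurable (lborel \<Otimes>\<^sub>M lborel)"
  unfolding seminorm_density_def[abs_def] by measurable

text \<open>Lebesgue measurable functions are exchanged for Borel representatives, for which the iterated
  seminorm is an integral over the product of Borel measures and Tonelli's theorem is available.\<close>
lemma W_space_iff:
  fixes u u0 :: "real^'n \<Rightarrow> real"
  assumes u: "u \<in> borel_measurable lebesgue" and u0 [measurable]: "u0 \<in> borel_measurable borel"
    and ae: "AE x in lborel. u x = u0 x" and \<Omega> [measurable]: "\<Omega> \<in> sets borel"
  shows "u \<in> W_space s \<Omega> \<longleftrightarrow>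
    (\<integral>\<^sup>+x. ennreal (indicator \<Omega> x * \<bar>u0 x\<bar>) \<partial>lborel) < \<infinity> \<and>
    (\<integral>\<^sup>+p. ennreal (seminorm_density s \<Omega> u0 p) \<partial>(lborel \<Otimes>\<^sub>M lborel)) < \<infinity>"
proof -
  have "(\<integral>\<^sup>+x\<in>\<Omega>. ennreal \<bar>u x\<bar> \<partial>lebesgue) = (\<integral>\<^sup>+x. ennreal (indicator \<Omega> x * \<bar>u0 x\<bar>) \<partial>lborel)"
    unfolding nn_integral_completion
    by (rule nn_integral_cong_AE, use ae in eventually_elim) (auto simp: indicator_def)
  moreover have "(\<integral>\<^sup>+x\<in>\<Omega>. (\<integral>\<^sup>+y\<in>\<Omega>.
      ennreal (\<bar>u x - u y\<bar> / norm (x - y) powr (real CARD('n) + s)) \<partial>lebesgue) \<partial>lebesgue)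
    = (\<integral>\<^sup>+x. \<integral>\<^sup>+y. ennreal (seminorm_density s \<Omega> u0 (x, y)) \<partial>lborel \<partial>lborel)"
    unfolding nn_integral_completion
  proof (rule nn_integral_cong_AE, use ae in eventually_elim)
    fix x assume x: "u x = u0 x"
    show "(\<integral>\<^sup>+y\<in>\<Omega>. ennreal (\<bar>u x - u y\<bar> / norm (x - y) powr (real CARD('n) + s)) \<partial>lborel) * indicator \<Omega> x
        = (\<integral>\<^sup>+y. ennreal (seminorm_density s \<Omega> u0 (x, y)) \<partial>lborel)"
    proof (cases "x \<in> \<Omega>")
      case True
      have "(\<integral>\<^sup>+y\<in>\<Omega>. ennreal (\<bar>u x - u y\<bar> / norm (x - y) powr (real CARD('n) + s)) \<partial>lborel)
          = (\<integral>\<^sup>+y. ennreal (seminorm_density s \<Omega> u0 (x, y)) \<partial>lborel)"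
        by (rule nn_integral_cong_AE, use ae in eventually_elim)
           (auto simp: x True seminorm_density_def frac_ker_def indicator_def)
      then show ?thesis using True by simp
    qed (simp add: seminorm_density_def)
  qed
  moreover have "(\<integral>\<^sup>+x. \<integral>\<^sup>+y. ennreal (seminorm_density s \<Omega> u0 (x, y)) \<partial>lborel \<partial>lborel)
      = (\<integral>\<^sup>+p. ennreal (seminorm_density s \<Omega> u0 p) \<partial>(lborel \<Otimes>\<^sub>M lborel))"
    by (rule lborel.nn_integral_fst)
       (rule measurable_compose[OF borel_measurable_seminorm_density[OF u0 \<Omega>] measurable_ennreal])
  ultimately show ?thesis using u by (simp add: W_space_def)
qed

text \<open>Inside the domain the cut varies at most like $u$ and the barrier.  If exactly one of the points
  lies outside, either the cut vanishes at both or the points are at distance at least $\sigma$,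
  where \<^const>\<open>near\<close> is $1$; this uses the margin $\sigma$ between the collar and the boundary.\<close>
lemma excess_diff_le_seminorm:
  fixes x y :: "real^'n"
  assumes \<sigma>: "0 < \<sigma>" and R: "\<rho> + 2 * \<sigma> \<le> 2 * R"
  defines "\<Omega> \<equiv> ball (0 :: real^'n) (2 * R)"
  shows "\<bar>excess u k \<rho> \<sigma> x - excess u k \<rho> \<sigma> y\<bar> * frac_ker s (x - y)
    \<le> seminorm_density s \<Omega> u (x, y)
      + (2 * \<sigma> * indicator \<Omega> x + 2 * \<sigma> * indicator \<Omega> y) * (near \<sigma> (x - y) * frac_ker s (x - y))"
proof -
  let ?w = "excess u k \<rho> \<sigma>"
  have near: "0 \<le> near \<sigma> (x - y)" using near_nonneg[OF \<sigma>] .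
  have "\<bar>?w x - ?w y\<bar> \<le> indicator \<Omega> x * indicator \<Omega> y * \<bar>u x - u y\<bar>
      + (2 * \<sigma> * indicator \<Omega> x + 2 * \<sigma> * indicator \<Omega> y) * near \<sigma> (x - y)"
  proof -
    have one: "\<bar>?w x' - ?w y'\<bar> \<le> 2 * \<sigma> * near \<sigma> (x' - y')" if "x' \<in> \<Omega>" "y' \<notin> \<Omega>" for x' y' :: "real^'n"
    proof (cases "?w x' = 0")
      case True
      have "?w y' = 0" using that(2) R \<sigma> by (intro excess_outside) (auto simp: \<Omega>_def)
      then show ?thesis using True near_nonneg[OF \<sigma>, of "x' - y'"] \<sigma> by simp
    next
      case False
      then have "0 < ?w x'" using excess_nonneg[of u k \<rho> \<sigma> x'] by linarith
      from excess_posD(1)[OF \<sigma> this] have x': "norm x' < \<rho> + \<sigma>" .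
      have "?w y' = 0" using that(2) R \<sigma> by (intro excess_outside) (auto simp: \<Omega>_def)
      moreover have "\<sigma> \<le> norm (x' - y')"
        using x' that(2) R norm_triangle_ineq3[of x' y'] by (simp add: \<Omega>_def)
      then have "near \<sigma> (x' - y') = 1" using \<sigma> by (simp add: near_def)
      ultimately show ?thesis using excess_le[OF \<sigma>, of u k \<rho> x'] \<sigma> by simp
    qed
    consider "x \<in> \<Omega>" "y \<in> \<Omega>" | "x \<in> \<Omega>" "y \<notin> \<Omega>" | "x \<notin> \<Omega>" "y \<in> \<Omega>" | "x \<notin> \<Omega>" "y \<notin> \<Omega>" by blast
    then show ?thesis
    proof cases
      case 1
      have "0 \<le> 2 * \<sigma> * near \<sigma> (x - y)" using \<sigma> near by simp
      then show ?thesis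
        using 1 excess_diff_le[of u k \<rho> \<sigma> x y] barrier_lipschitz[OF \<sigma>, of k \<rho> x y] by (simp add: distrib_right)
    next
      case 2
      then show ?thesis using one[of x y] by simp
    next
      case 3
      then show ?thesis using one[of y x] frac_ker_minus(2)[of \<sigma> "x - y"] by (simp add: abs_minus_commute)
    next
      case 4
      then have "?w x = 0" "?w y = 0" using R \<sigma> by (auto intro!: excess_outside simp: \<Omega>_def)
      then show ?thesis using 4 by simp
    qed
  qed
  then have "\<bar>?w x - ?w y\<bar> * frac_ker s (x - y) \<le> (indicator \<Omega> x * indicator \<Omega> y * \<bar>u x - u y\<bar>
      + (2 * \<sigma> * indicator \<Omega> x + 2 * \<sigma> * indicator \<Omega> y) * near \<sigma> (x - y)) * frac_ker s (x - y)"
    by (intro mult_right_mono) auto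
  then show ?thesis by (simp add: seminorm_density_def distrib_right mult.assoc)
qed

lemma borel_measurable_energy_gap:
  fixes u v :: "real^'n \<Rightarrow> real"
  assumes [measurable]: "u \<in> borel_measurable borel" "v \<in> borel_measurable borel"
  shows "(\<lambda>(x, y). energy_gap s u v x y) \<in> borel_measurable (lborel \<Otimes>\<^sub>M lborel)"
proof -
  have q: "(\<lambda>p. (f (fst p) - f (snd p)) / norm (fst p - snd p :: real^'n)) \<in> borel_measurable (lborel \<Otimes>\<^sub>M lborel)"
    if [measurable]: "f \<in> borel_measurable borel" for f :: "real^'n \<Rightarrow> real" by measurable
  have [measurable]: "(\<lambda>p. GG_int CARD('n) s ((f (fst p) - f (snd p)) / norm (fst p - snd p :: real^'n)))
      \<in> borel_measurable (lborel \<Otimes>\<^sub>M lborel)"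
    if "f \<in> borel_measurable borel" for f :: "real^'n \<Rightarrow> real"
    by (rule measurable_compose[OF q[OF that] borel_measurable_GG_int])
  show ?thesis unfolding energy_gap_def split_beta' by measurable
qed

text \<open>The cut applied to $u$ is built from a Borel representative, so that it is Borel itself, while the
  competitor is formed from $u$ proper, so that it keeps the exterior data at every point.\<close>
lemma obstacle_solution_is_truncation_minimiser:
  fixes u :: "real^'n \<Rightarrow> real"
  assumes s: "0 < s" and R: "0 < R" and J: "0 < J" and eps: "0 < \<epsilon>" "\<epsilon> \<le> 1"
    and kernel_bound: "\<And>\<sigma>. 0 < \<sigma> \<Longrightarrow>
      (\<integral>\<^sup>+z. ennreal (near \<sigma> z * frac_ker s z) \<partial>(lborel :: (real^'n) measure)) \<le> ennreal (J * \<sigma> powr (-s))"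
    and eps_small: "16 * J * \<epsilon> powr s * 2 ^ CARD('n) \<le> g_dens CARD('n) s 3 * unit_ball_vol (real CARD('n))"
    and sol: "solves_obstacle s \<phi> \<psi> (ball 0 (2 * R)) A u"
    and \<psi>: "AE x in lborel. x \<in> A \<longrightarrow> \<psi> x \<le> M"
  obtains u0 where "truncation_minimiser s J \<epsilon> R M (unit_ball_vol (real CARD('n))) (g_dens CARD('n) s 3) u0"
    and "AE x in lborel. u x = u0 x"
proof -
  define \<Omega> where "\<Omega> = ball (0 :: real^'n) (2 * R)"
  have [measurable]: "\<Omega> \<in> sets borel" by (simp add: \<Omega>_def)
  have u_W: "u \<in> W_space s \<Omega>" and u_out: "\<And>x. x \<notin> \<Omega> \<Longrightarrow> u x = \<phi> x"
    and u_\<psi>: "AE x in lborel. x \<in> A \<longrightarrow> \<psi> x \<le> u x"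
    using sol by (auto simp: solves_obstacle_def W_obst_def \<Omega>_def AE_completion_iff)
  have u_meas: "u \<in> borel_measurable lebesgue" using u_W by (simp add: W_space_def)
  obtain u0 where u0: "u0 \<in> borel_measurable lborel" and ae: "AE x in lborel. u x = u0 x"
    using completion_ex_borel_measurable_real[OF u_meas] by blast
  have [measurable]: "u0 \<in> borel_measurable borel" using u0 by simp
  have fin1: "(\<integral>\<^sup>+x. ennreal (indicator \<Omega> x * \<bar>u0 x\<bar>) \<partial>lborel) < \<infinity>"
    and fin2: "(\<integral>\<^sup>+p. ennreal (seminorm_density s \<Omega> u0 p) \<partial>(lborel \<Otimes>\<^sub>M lborel)) < \<infinity>"
    using W_space_iff[OF u_meas _ ae, of \<Omega> s] u_W by simp_all
  have u0_L1: "integrable lborel (\<lambda>x. indicator \<Omega> x * \<bar>u0 x\<bar>)"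
    using fin1 by (intro integrableI_nonneg) auto
  have sd_meas: "seminorm_density s \<Omega> f \<in> borel_measurable (lborel \<Otimes>\<^sub>M lborel)"
    if "f \<in> borel_measurable borel" for f using that by (rule borel_measurable_seminorm_density) simp
  have sd_int: "integrable (lborel \<Otimes>\<^sub>M lborel) (seminorm_density s \<Omega> u0)"
    using fin2 sd_meas[of u0] by (intro integrableI_nonneg) (auto simp: seminorm_density_nonneg)
  have key: "integrable (lborel \<Otimes>\<^sub>M lborel) (\<lambda>(x, y). (excess u0 k \<rho> \<sigma> x - excess u0 k \<rho> \<sigma> y) * frac_ker s (x - y)) \<and>
      integrable (lborel \<Otimes>\<^sub>M lborel) (\<lambda>(x, y). energy_gap s u0 (\<lambda>x. u0 x - excess u0 k \<rho> \<sigma> x) x y) \<and>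
      (\<integral>(x, y). energy_gap s u0 (\<lambda>x. u0 x - excess u0 k \<rho> \<sigma> x) x y \<partial>(lborel \<Otimes>\<^sub>M lborel)) \<le> 0"
    if k: "M \<le> k" and \<rho>: "0 < \<rho>" and \<sigma>: "0 < \<sigma>" and \<rho>R: "\<rho> + 2 * \<sigma> \<le> 2 * R" for k \<rho> \<sigma>
  proof -
    define w where "w = excess u0 k \<rho> \<sigma>"
    have [measurable]: "w \<in> borel_measurable borel" unfolding w_def by measurable
    define v0 where "v0 x = u0 x - w x" for x
    have [measurable]: "v0 \<in> borel_measurable borel" unfolding v0_def[abs_def] by measurable
    let ?d = "\<lambda>(x, y). (w x - w y) * frac_ker s (x - y)"
    let ?gap = "\<lambda>(x, y). energy_gap s u0 v0 x y"
    have e_int: "integrable lborel (\<lambda>x. 2 * \<sigma> * indicator \<Omega> x :: real)"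
    proof (intro integrable_mult_right)
      have "emeasure lborel \<Omega> < \<infinity>" by (rule emeasure_bounded_finite) (simp add: \<Omega>_def)
      then show "integrable lborel (indicator \<Omega> :: _ \<Rightarrow> real)" by simp
    qed
    have e0: "0 \<le> 2 * \<sigma> * (indicator \<Omega> x :: real)" for x using \<sigma> by simp
    note weight = weight_integral(1)[OF e_int e0 \<sigma> J kernel_bound[OF \<sigma>]]
    have d_int: "integrable (lborel \<Otimes>\<^sub>M lborel) ?d"
    proof (rule Bochner_Integration.integrable_bound[OF Bochner_Integration.integrable_add[OF sd_int weight]])
      show "?d \<in> borel_measurable (lborel \<Otimes>\<^sub>M lborel)" by measurable
      have "norm (?d p) \<le> norm (seminorm_density s \<Omega> u0 p + (case p of (x, y) \<Rightarrow>
          (2 * \<sigma> * indicator \<Omega> x + 2 * \<sigma> * indicator \<Omega> y) * (near \<sigma> (x - y) * frac_ker s (x - y))))" for p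
      proof -
        obtain x y where p: "p = (x, y)" by (cases p)
        show ?thesis
          using excess_diff_le_seminorm[OF \<sigma> \<rho>R, of u0 k x y s]
          unfolding w_def[symmetric] \<Omega>_def[symmetric] by (simp add: p abs_mult)
      qed
      then show "AE p in lborel \<Otimes>\<^sub>M lborel. norm (?d p) \<le> norm (seminorm_density s \<Omega> u0 p + (case p of (x, y) \<Rightarrow>
          (2 * \<sigma> * indicator \<Omega> x + 2 * \<sigma> * indicator \<Omega> y) * (near \<sigma> (x - y) * frac_ker s (x - y))))" by simp
    qed
    have gap_meas: "?gap \<in> borel_measurable (lborel \<Otimes>\<^sub>M lborel)"
      by (rule borel_measurable_energy_gap) measurable
    have gap_int: "integrable (lborel \<Otimes>\<^sub>M lborel) ?gap"
    proof (rule Bochner_Integration.integrable_bound[OF integrable_mult_right[OF d_int, of 2] gap_meas])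
      have "norm (?gap p) \<le> norm (2 * ?d p)" for p
      proof -
        obtain x y where p: "p = (x, y)" by (cases p)
        show ?thesis using abs_energy_gap_le[OF s, of u0 w x y] by (simp add: p v0_def[abs_def] abs_mult)
      qed
      then show "AE p in lborel \<Otimes>\<^sub>M lborel. norm (?gap p) \<le> norm (2 * ?d p)" by simp
    qed
    define v where "v x = u x - w x" for x
    have w_out: "w x = 0" if "x \<notin> \<Omega>" for x
      unfolding w_def using that \<rho>R \<sigma> by (intro excess_outside) (auto simp: \<Omega>_def)
    have v_ae: "AE x in lborel. v x = v0 x" using ae by eventually_elim (simp add: v_def v0_def)
    have v_meas: "v \<in> borel_measurable lebesgue"
      unfolding v_def[abs_def] by (rule borel_measurable_diff[OF u_meas measurable_completion]) simp
    have v_W: "v \<in> W_space s \<Omega>"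
    proof -
      have "(\<integral>\<^sup>+x. ennreal (indicator \<Omega> x * \<bar>v0 x\<bar>) \<partial>lborel) < \<infinity>"
      proof -
        have "integrable lborel (\<lambda>x. indicator \<Omega> x * \<bar>v0 x\<bar>)"
        proof (rule Bochner_Integration.integrable_bound[OF Bochner_Integration.integrable_add[OF u0_L1 e_int]])
          have "\<bar>v0 x\<bar> \<le> \<bar>u0 x\<bar> + 2 * \<sigma>" for x
            using excess_le[OF \<sigma>, of u0 k \<rho> x] excess_nonneg[of u0 k \<rho> \<sigma> x] unfolding v0_def w_def by linarith
          then have "norm (indicator \<Omega> x * \<bar>v0 x\<bar>) \<le> norm (indicator \<Omega> x * \<bar>u0 x\<bar> + 2 * \<sigma> * indicator \<Omega> x)" for x
            using \<sigma> by (cases "x \<in> \<Omega>") (simp_all add: abs_of_nonneg)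
          then show "AE x in lborel. norm (indicator \<Omega> x * \<bar>v0 x\<bar>) \<le> norm (indicator \<Omega> x * \<bar>u0 x\<bar> + 2 * \<sigma> * indicator \<Omega> x)"
            by simp
        qed measurable
        then show ?thesis by (simp add: integrable_iff_bounded)
      qed
      moreover have "(\<integral>\<^sup>+p. ennreal (seminorm_density s \<Omega> v0 p) \<partial>(lborel \<Otimes>\<^sub>M lborel)) < \<infinity>"
      proof -
        have "integrable (lborel \<Otimes>\<^sub>M lborel) (seminorm_density s \<Omega> v0)"
        proof (rule Bochner_Integration.integrable_bound[OF Bochner_Integration.integrable_add[OF sd_int integrable_abs[OF d_int]]])
          have "seminorm_density s \<Omega> v0 p \<le> seminorm_density s \<Omega> u0 p + \<bar>?d p\<bar>" for p
          proof -
            obtain x y where p: "p = (x, y)" by (cases p)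
            have "\<bar>v0 x - v0 y\<bar> * frac_ker s (x - y) \<le> (\<bar>u0 x - u0 y\<bar> + \<bar>w x - w y\<bar>) * frac_ker s (x - y)"
              by (intro mult_right_mono) (auto simp: v0_def)
            then show ?thesis
              by (auto simp: p seminorm_density_def indicator_def abs_mult distrib_right)
          qed
          then show "AE p in lborel \<Otimes>\<^sub>M lborel. norm (seminorm_density s \<Omega> v0 p) \<le> norm (seminorm_density s \<Omega> u0 p + \<bar>?d p\<bar>)"
            using seminorm_density_nonneg[of s \<Omega>] by (simp add: add_nonneg_nonneg)
        qed (rule sd_meas, simp)
        then show ?thesis by (simp add: integrable_iff_bounded seminorm_density_nonneg)
      qed
      ultimately show ?thesis using W_space_iff[OF v_meas _ v_ae, of \<Omega> s] by simp
    qed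
    have "AE x in lborel. x \<in> A \<longrightarrow> \<psi> x \<le> v x"
      using u_\<psi> \<psi> ae
    proof eventually_elim
      case (elim x)
      show ?case
      proof
        assume "x \<in> A"
        show "\<psi> x \<le> v x"
        proof (cases "w x = 0")
          case True
          then show ?thesis using elim \<open>x \<in> A\<close> by (simp add: v_def)
        next
          case False
          then have "0 < w x" using excess_nonneg[of u0 k \<rho> \<sigma> x] unfolding w_def by linarith
          then have "k \<le> u0 x - w x"
            using excess_posD(3)[OF \<sigma>, of u0 k \<rho> x] barrier_bounds(1)[OF \<sigma>, of k \<rho> x] unfolding w_def by linarith
          then show ?thesis using elim \<open>x \<in> A\<close> k by (simp add: v_def)
        qed
      qed
    qed
    then have "v \<in> W_obst s \<phi> \<psi> \<Omega> A"
      using v_W u_out w_out by (auto simp: W_obst_def AE_completion_iff v_def)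
    then have min: "(LINT p:Q_dom \<Omega>|lebesgue. (case p of (x, y) \<Rightarrow>
           (GG_int CARD('n) s ((u x - u y) / norm (x - y)) - GG_int CARD('n) s ((v x - v y) / norm (x - y)))
           * (1 / norm (x - y) powr (real CARD('n) - 1 + s)))) \<le> 0"
      using sol unfolding solves_obstacle_def \<Omega>_def by blast
    have "AE p in lborel \<Otimes>\<^sub>M lborel. ?gap p = indicator (Q_dom \<Omega>) p *\<^sub>R (case p of (x, y) \<Rightarrow> energy_gap s u v x y)"
      using AE_product_both[OF ae] AE_product_both[OF v_ae]
    proof eventually_elim
      case (elim p)
      obtain x y where p: "p = (x, y)" by (cases p)
      show ?case
      proof (cases "p \<in> Q_dom \<Omega>")
        case True
        then show ?thesis using elim by (simp add: p energy_gap_def)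
      next
        case False
        then have "w x = 0" "w y = 0" using w_out by (auto simp: Q_dom_def p)
        then show ?thesis using False by (simp add: p energy_gap_def v0_def)
      qed
    qed
    then have ae_eq: "AE p in lebesgue. ?gap p = indicator (Q_dom \<Omega>) p *\<^sub>R (case p of (x, y) \<Rightarrow> energy_gap s u v x y)"
      unfolding AE_completion_iff lborel_prod .
    have gap_meas': "?gap \<in> borel_measurable lborel" using gap_meas by (simp only: lborel_prod)
    then have gap_leb: "?gap \<in> borel_measurable lebesgue" by (rule measurable_completion)
    have "integral\<^sup>L (lborel \<Otimes>\<^sub>M lborel) ?gap = integral\<^sup>L lebesgue ?gap"
      unfolding lborel_prod by (rule integral_completion[symmetric, OF gap_meas'])
    also have "\<dots> = integral\<^sup>L lebesgue (\<lambda>p. indicator (Q_dom \<Omega>) p *\<^sub>R (case p of (x, y) \<Rightarrow> energy_gap s u v x y))"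
      by (rule integral_cong_AE[OF gap_leb borel_measurable_AE[OF gap_leb ae_eq] ae_eq])
    also have "\<dots> \<le> 0"
      using min unfolding set_lebesgue_integral_def energy_gap_def .
    finally have "integral\<^sup>L (lborel \<Otimes>\<^sub>M lborel) ?gap \<le> 0" .
    with d_int gap_int show ?thesis unfolding w_def v0_def[abs_def] by blast
  qed
  have "truncation_minimiser s J \<epsilon> R M (unit_ball_vol (real CARD('n))) (g_dens CARD('n) s 3) u0"
    by (rule truncation_minimiser.intro[OF refl refl s J eps kernel_bound eps_small]) (use key in auto)
  with ae that show ?thesis by blast
qed

section \<open>The supremum bound\<close>

context truncation_minimiser
begin

text \<open>The iteration runs on the scale $R/32$, starting from $B_{3R/2}$; its total rise $R/8$ is the height
  of the barrier in the comparison on the scale $R/8$, whose low values $u \le N - R/8$ include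
  $u \le N/2$.\<close>
lemma sup_bound:
  assumes R: "0 < R" and N: "M \<le> N" "0 < N" "R \<le> 4 * N"
    and few: "measure lborel {x \<in> ball 0 (2 * R). N / 2 < u x} \<le> V / 2 * (\<epsilon> * R / 32) ^ CARD('n)"
  shows "AE x in lborel. norm x < R \<longrightarrow> u x \<le> N"
proof -
  have few1: "measure lborel {x \<in> ball 0 (3 * R / 2). N < u x} \<le> V / 2 * (\<epsilon> * (R / 32)) ^ CARD('n)"
    using order_trans[OF measure_superlevel_mono few, of "3 * R / 2" N] R N by simp
  have "AE x in lborel. norm x < 3 * R / 2 - 2 * (R / 32) \<longrightarrow> u x \<le> N + 4 * (R / 32)"
    by (rule bounded_by_level) (use R N few1 in auto)
  then have bd: "AE x in lborel. norm x < R + 2 * (R / 8) \<longrightarrow> u x \<le> N + R / 8"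
    by eventually_elim (use R in auto)
  have few2: "measure lborel {x \<in> ball 0 (R + 2 * (R / 8)). N - R / 8 < u x} \<le> V / 2 * (\<epsilon> * (R / 8)) ^ CARD('n)"
  proof -
    have "measure lborel {x \<in> ball 0 (R + 2 * (R / 8)). N - R / 8 < u x} \<le> V / 2 * (\<epsilon> * R / 32) ^ CARD('n)"
      using order_trans[OF measure_superlevel_mono few, of "R + 2 * (R / 8)" "N - R / 8"] R N by simp
    also have "\<dots> \<le> V / 2 * (\<epsilon> * (R / 8)) ^ CARD('n)"
      using V_pos eps R by (intro mult_left_mono power_mono) auto
    finally show ?thesis .
  qed
  show ?thesis
    by (rule barrier_comparison[OF N(1) R _ _ bd few2]) (use R in auto)
qed

end

theorem theorem2p8:
  fixes s :: real
  assumes "0 < s" and "s < 1"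
  shows "\<exists>C::real. C > 0 \<and>
    (\<forall>(\<phi> :: real^'n::finite \<Rightarrow> real) (R :: real) (A :: (real^'n) set)
       (\<psi> :: real^'n \<Rightarrow> real) (u :: real^'n \<Rightarrow> real).
       \<phi> \<in> borel_measurable lebesgue \<longrightarrow> R > 0 \<longrightarrow>
       open A \<longrightarrow> A \<subseteq> ball 0 (2 * R) \<longrightarrow> \<psi> \<in> L_infty A \<longrightarrow>
       solves_obstacle s \<phi> \<psi> (ball 0 (2 * R)) A u \<longrightarrow>
       esssup (lebesgue_on (ball 0 R)) (\<lambda>x. ereal (u x))
         \<le> max (ereal (C * (R + 1 / measure lebesgue (ball (0 :: real^'n) (2 * R))
                              * (LINT x:ball 0 (2 * R)|lebesgue. max (u x) 0))))
                (esssup (lebesgue_on A) (\<lambda>x. ereal (max (\<psi> x) 0))))"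
proof -
  define V where "V = unit_ball_vol (real CARD('n))"
  define c where "c = g_dens CARD('n) s 3"
  have V: "0 < V" and c: "0 < c" by (simp_all add: V_def c_def g_dens_pos)
  obtain J where J: "0 < J" and kernel_bound: "\<And>\<sigma>. 0 < \<sigma> \<Longrightarrow>
      (\<integral>\<^sup>+z. ennreal (near \<sigma> z * frac_ker s z) \<partial>(lborel :: (real^'n) measure)) \<le> ennreal (J * \<sigma> powr (-s))"
    using kernel_integral_bound[OF assms, where 'n = 'n] by blast
  define q where "q = c * V / (16 * J * 2 ^ CARD('n))"
  have q: "0 < q" using c V J by (simp add: q_def)
  define \<epsilon> where "\<epsilon> = min 1 (q powr (1 / s))"
  have eps: "0 < \<epsilon>" "\<epsilon> \<le> 1" using q by (auto simp: \<epsilon>_def)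
  have "\<epsilon> powr s \<le> (q powr (1 / s)) powr s"
    using eps(1) assms by (intro powr_mono2) (auto simp: \<epsilon>_def)
  also have "\<dots> = q" using assms q by (simp add: powr_powr)
  finally have "16 * J * \<epsilon> powr s * 2 ^ CARD('n) \<le> 16 * J * q * 2 ^ CARD('n)"
    using J by (intro mult_left_mono mult_right_mono) auto
  also have "\<dots> = c * V" using J by (simp add: q_def)
  finally have eps_small: "16 * J * \<epsilon> powr s * 2 ^ CARD('n) \<le> c * V" .
  \<comment> \<open>Chebyshev bounds the measure of $\{u > N/2\}$ by $2 |B_{2R}| / C$; this value of $C$ makes it
    half the volume of a ball of radius $\epsilon R / 32$.\<close>
  define C where "C = 4 * (64 / \<epsilon>) ^ CARD('n)"
  have "1 \<le> (64 / \<epsilon>) ^ CARD('n)" using eps by (intro one_le_power) (auto simp: field_simps)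
  then have C: "4 \<le> C" by (simp add: C_def)
  have "esssup (lebesgue_on (ball 0 R)) (\<lambda>x. ereal (u x))
         \<le> max (ereal (C * (R + 1 / measure lebesgue (ball (0 :: real^'n) (2 * R))
                              * (LINT x:ball 0 (2 * R)|lebesgue. max (u x) 0))))
                (esssup (lebesgue_on A) (\<lambda>x. ereal (max (\<psi> x) 0)))"
    (is "?S \<le> max (ereal ?B) ?E")
    if R: "R > 0" and A: "open A" and sol: "solves_obstacle s \<phi> \<psi> (ball 0 (2 * R)) A u"
    for \<phi> :: "real^'n \<Rightarrow> real" and R A \<psi> u
  proof (cases "?E = \<infinity>")
    case True
    then show ?thesis by simp
  next
    case False
    have "max (ereal ?B) ?E \<noteq> \<infinity>" "max (ereal ?B) ?E \<noteq> - \<infinity>" using False by (auto simp: max_def)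
    \<comment> \<open>If $A$ is null, the supremum over $A$ is $-\infty$, but the maximum is still a real number.\<close>
    then obtain N where N: "max (ereal ?B) ?E = ereal N" by (cases "max (ereal ?B) ?E") auto
    have BN: "?B \<le> N" using N by (metis ereal_less_eq(3) max.cobounded1)
    have EN: "?E \<le> ereal N" using N by (metis max.cobounded2)
    have "AE x in lebesgue_on A. ereal (max (\<psi> x) 0) \<le> ?E" by (rule esssup_AE)
    then have "AE x in lebesgue_on A. \<psi> x \<le> N"
    proof eventually_elim
      case (elim x)
      then have "ereal (max (\<psi> x) 0) \<le> ereal N" using EN by (rule order_trans)
      then show ?case by simp
    qed
    then have \<psi>: "AE x in lborel. x \<in> A \<longrightarrow> \<psi> x \<le> N"
      using A by (simp add: AE_restrict_space_iff AE_completion_iff)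
    obtain u0 where min: "truncation_minimiser s J \<epsilon> R N V c u0" and ae: "AE x in lborel. u x = u0 x"
      using obstacle_solution_is_truncation_minimiser[OF assms(1) R J eps kernel_bound _ sol \<psi>] eps_small
      unfolding V_def c_def by blast
    interpret truncation_minimiser s J \<epsilon> R N V c u0 by (rule min)
    define \<Omega> where "\<Omega> = ball (0 :: real^'n) (2 * R)"
    have [measurable]: "\<Omega> \<in> sets borel" by (simp add: \<Omega>_def)
    define b where "b = V * (2 * R) ^ CARD('n)"
    have b: "0 < b" using V R by (simp add: b_def)
    have vol: "measure lebesgue \<Omega> = b"
      using emeasure_ball_scale[of "2 * R" "0 :: real^'n"] R V
      by (simp add: \<Omega>_def measure_def b_def V_def)
    have u_W: "u \<in> W_space s \<Omega>" using sol by (simp add: solves_obstacle_def W_obst_def \<Omega>_def)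
    then have u_meas: "u \<in> borel_measurable lebesgue" by (simp add: W_space_def)
    have "(\<integral>\<^sup>+x. ennreal (indicator \<Omega> x * \<bar>u0 x\<bar>) \<partial>lborel) < \<infinity>"
      using W_space_iff[OF u_meas u_borel ae, of \<Omega> s] u_W by simp
    then have L1: "integrable lborel (\<lambda>x. indicator \<Omega> x * \<bar>u0 x\<bar>)" by (intro integrableI_nonneg) auto
    define m where "m = (\<integral>x. indicator \<Omega> x * max (u0 x) 0 \<partial>lborel)"
    have m_int: "integrable lborel (\<lambda>x. indicator \<Omega> x * max (u0 x) 0)"
      by (rule Bochner_Integration.integrable_bound[OF L1]) (auto simp: indicator_def)
    have m0: "0 \<le> m" unfolding m_def by (intro integral_nonneg_AE) auto
    have LINT: "(LINT x:\<Omega>|lebesgue. max (u x) 0) = m"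
    proof -
      have meas: "(\<lambda>x. indicator \<Omega> x * max (u0 x) 0) \<in> borel_measurable lborel" by measurable
      have "AE x in lborel. indicator \<Omega> x * max (u0 x) 0 = indicator \<Omega> x *\<^sub>R max (u x) 0"
        using ae by eventually_elim simp
      then have eq: "AE x in lebesgue. indicator \<Omega> x * max (u0 x) 0 = indicator \<Omega> x *\<^sub>R max (u x) 0"
        unfolding AE_completion_iff .
      have leb: "(\<lambda>x. indicator \<Omega> x * max (u0 x) 0) \<in> borel_measurable lebesgue"
        by (rule measurable_completion[OF meas])
      have "(LINT x:\<Omega>|lebesgue. max (u x) 0) = (\<integral>x. indicator \<Omega> x * max (u0 x) 0 \<partial>lebesgue)"
        unfolding set_lebesgue_integral_def
        by (rule integral_cong_AE[OF leb borel_measurable_AE[OF leb eq] eq, symmetric])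
      also have "\<dots> = m" unfolding m_def by (rule integral_completion[OF meas])
      finally show ?thesis .
    qed
    have B: "?B = C * (R + m / b)" using LINT vol by (simp add: \<Omega>_def)
    have "C * R \<le> C * (R + m / b)" using C m0 b by (intro mult_left_mono) auto
    moreover have "4 * R \<le> C * R" using C R by (intro mult_right_mono) auto
    ultimately have N4: "4 * R \<le> N" using BN B by linarith
    then have N0: "0 < N" using R by linarith
    have "C * (m / b) \<le> C * (R + m / b)" using C R by (intro mult_left_mono) auto
    also have "\<dots> \<le> N" using BN unfolding B .
    finally have "C * (m / b) * (b / C) \<le> N * (b / C)" using C b by (intro mult_right_mono) auto
    then have mN: "m \<le> N * (b / C)" using C b by simp
    define T where "T = {x \<in> \<Omega>. N / 2 < u0 x}"
    have T: "T \<in> fmeasurable lborel" unfolding T_def \<Omega>_def by (rule superlevel_fmeasurable)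
    have "N / 2 * measure lborel T = (\<integral>x. N / 2 * indicator T x \<partial>lborel)" by simp
    also have "\<dots> \<le> m" unfolding m_def
    proof (rule integral_mono[OF _ m_int])
      show "integrable lborel (\<lambda>x. N / 2 * indicator T x)"
        using T by (intro integrable_mult_right) (simp add: fmeasurable_def)
      show "N / 2 * indicator T x \<le> indicator \<Omega> x * max (u0 x) 0" for x
        by (auto simp: T_def indicator_def)
    qed
    also note mN
    finally have "N * measure lborel T \<le> N * (2 * b / C)" by (simp add: mult_ac)
    from mult_le_cancel_left_pos[OF N0, THEN iffD1, OF this] have "measure lborel T \<le> 2 * b / C" .
    also have "\<dots> = V / 2 * (\<epsilon> * R / 32) ^ CARD('n)"
    proof -
      have "(2 * R) ^ CARD('n) = (64 / \<epsilon>) ^ CARD('n) * (\<epsilon> * R / 32) ^ CARD('n)"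
        unfolding power_mult_distrib[symmetric] using eps by simp
      moreover have "(64 / \<epsilon>) ^ CARD('n) \<noteq> 0" using eps by simp
      ultimately show ?thesis by (simp add: b_def C_def)
    qed
    finally have "measure lborel {x \<in> ball 0 (2 * R). N / 2 < u0 x} \<le> V / 2 * (\<epsilon> * R / 32) ^ CARD('n)"
      by (simp add: T_def \<Omega>_def)
    from sup_bound[OF R order_refl N0 _ this] N4 R
    have "AE x in lborel. norm x < R \<longrightarrow> u0 x \<le> N" by simp
    then have "AE x in lborel. norm x < R \<longrightarrow> u x \<le> N" using ae by eventually_elim simp
    then have "AE x in lebesgue_on (ball 0 R). ereal (u x) \<le> ereal N"
      by (simp add: AE_restrict_space_iff AE_completion_iff)
    moreover have "(\<lambda>x. ereal (u x)) \<in> borel_measurable (lebesgue_on (ball 0 R))"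
      using u_meas by (intro borel_measurable_ereal measurable_restrict_space1)
    ultimately show ?thesis unfolding N by (intro esssup_I)
  qed
  then show ?thesis using C by (intro exI[of _ C]) auto
qed

end
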